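(* Let $f:\mathbb{T}^d\to\mathbb{R}$, and for dyadic $N\ge 1$ define $f_N(x)=\sum_{N<\max_i|m_i|\le2N}\widehat f(m)e^{im\cdot x}$. Assume that for some $s\in(0,1]$ and some constant $C$, $\|f_N\|_{L^1(\mathbb{T}^d)}\le CN^{-(\frac d2+s)}$ for all dyadic $N\ge1$. Define $$u(x,t)=\sum_{m\in\mathbb{Z}^d}e^{i|m|^2t}\widehat f(m)e^{im\cdot x}.$$ Then for almost every $t$, $u(\cdot,t)\in C^{\gamma'}(\mathbb{T}^d)$ for every $0<\gamma'<s$, and $\dim_t(f)\le(d+1)-s$.
   Context: $\mathbb{T}^d=(\mathbb{R}/2\pi\mathbb{Z})^d$, $\widehat f(m)$, $m\in\mathbb Z^d$, are the Fourier coefficients of $f$, with $f\in L^2(\mathbb{T}^d)$. The fractal (upper Minkowski) dimension of a bounded set $E$ is $\limsup_{\epsilon\to0}\frac{\log\mathcal N(E,\epsilon)}{\log(1/\epsilon)}$, where $\mathcal N(E,\epsilon)$ is the minimum number of boxes of sidelength $\epsilon$ needed to cover $E$. $\dim_t(f)$ denotes the maximum of the fractal dimensions of the graphs of the real and imaginary parts of $u(\cdot,t)$. $C^{\gamma'}$ is the Hölder space. *)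

theory Defs
  imports "HOL-Analysis.Analysis"
begin

text \<open>
  Functions on the torus \<open>(\<real>/2\<pi>\<int>)^d\<close>, with \<open>d = CARD('n)\<close>, are functions on
  \<open>real^'n\<close> that are \<open>2\<pi>\<close>-periodic in every coordinate; integrals over the torus are
  (unnormalised) integrals over the fundamental cube.
\<close>

definition periodic :: "(real^'n \<Rightarrow> 'a) \<Rightarrow> bool" where
  "periodic g \<longleftrightarrow> (\<forall>x i. g (x + axis i (2 * pi)) = g x)"

definition cube :: "(real^'n) set" where
  "cube = cbox 0 (\<chi> i. 2 * pi)"

definition L2_torus :: "(real^'n \<Rightarrow> 'a :: {real_normed_vector, second_countable_topology}) \<Rightarrow> bool" where
  "L2_torus g \<longleftrightarrow> periodic g \<and> g \<in> borel_measurable lebesgue \<and>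
     integrable (lebesgue_on cube) (\<lambda>x. (norm (g x))\<^sup>2)"

definition L1_norm :: "(real^'n \<Rightarrow> complex) \<Rightarrow> real" where
  "L1_norm g = (LINT x|lebesgue_on cube. norm (g x))"

definition freq_dot :: "int^'n \<Rightarrow> real^'n \<Rightarrow> real" where
  "freq_dot m x = (\<Sum>i\<in>UNIV. real_of_int (m $ i) * x $ i)"

definition freq_sq :: "int^'n \<Rightarrow> int" where
  "freq_sq m = (\<Sum>i\<in>UNIV. (m $ i)\<^sup>2)"

definition freq_max :: "int^'n \<Rightarrow> int" where
  "freq_max m = (MAX i. \<bar>m $ i\<bar>)"

definition fourier_coeff :: "(real^'n \<Rightarrow> real) \<Rightarrow> int^'n \<Rightarrow> complex" where
  "fourier_coeff f m =
     (LINT x|lebesgue_on cube. of_real (f x) * cis (- freq_dot m x)) / of_real ((2 * pi) ^ CARD('n))"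

lemma finite_freq_max: "finite {m :: int^'n. freq_max m \<le> K}"
proof -
  have "{m :: int^'n. freq_max m \<le> K} \<subseteq> vec_lambda ` (UNIV \<rightarrow>\<^sub>E {-K..K})"
  proof
    fix m :: "int^'n"
    assume "m \<in> {m. freq_max m \<le> K}"
    hence *: "\<bar>m $ i\<bar> \<le> K" for i
      unfolding freq_max_def by simp
    have "vec_nth m \<in> UNIV \<rightarrow>\<^sub>E {-K..K}"
      using * by (auto simp: PiE_def abs_le_iff minus_le_iff)
    moreover have "m = vec_lambda (vec_nth m)" by simp
    ultimately show "m \<in> vec_lambda ` (UNIV \<rightarrow>\<^sub>E {-K..K})" by blast
  qed
  moreover have "finite ((UNIV :: 'n set) \<rightarrow>\<^sub>E {-K..K})"
    by (intro finite_PiE) auto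
  ultimately show ?thesis
    using finite_subset by blast
qed

definition freq_block :: "(real^'n \<Rightarrow> real) \<Rightarrow> nat \<Rightarrow> real^'n \<Rightarrow> complex" where
  "freq_block f N x =
     (\<Sum>m | int N < freq_max m \<and> freq_max m \<le> 2 * int N. fourier_coeff f m * cis (freq_dot m x))"

text \<open>
  For \<open>f\<close> in \<open>L\<^sup>2\<close> the series defining \<open>u(\<cdot>,t)\<close> converges in \<open>L\<^sup>2\<close>, in general neither absolutely nor
  pointwise, so \<open>u(\<cdot>,t)\<close> is an \<open>L\<^sup>2\<close> class. The predicate says that \<open>v\<close> is a representative of
  \<open>u(\<cdot>,t)\<close>, i.e. an unconditional \<open>L\<^sup>2\<close> sum of the series. Any two representatives agree almost
  everywhere, so there is at most one continuous one.
\<close>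

definition evolution :: "(real^'n \<Rightarrow> real) \<Rightarrow> real \<Rightarrow> (real^'n \<Rightarrow> complex) \<Rightarrow> bool" where
  "evolution f t v \<longleftrightarrow> L2_torus v \<and>
     ((\<lambda>F. LINT x|lebesgue_on cube.
        (norm (v x - (\<Sum>m\<in>F. cis (of_int (freq_sq m) * t) * fourier_coeff f m * cis (freq_dot m x))))\<^sup>2)
      \<longlongrightarrow> 0) (finite_subsets_at_top UNIV)"

text \<open>
  For periodic functions, testing the condition with the Euclidean distance on \<open>real^'n\<close> is the same as
  testing it with the quotient distance of the torus, and boundedness is automatic.
  Used for exponents in \<open>(0,1)\<close> only.
\<close>

definition holder_torus :: "real \<Rightarrow> (real^'n \<Rightarrow> complex) \<Rightarrow> bool" where
  "holder_torus \<gamma> v \<longleftrightarrow> periodic v \<and> (\<exists>K. \<forall>x y. dist (v x) (v y) \<le> K * dist x y powr \<gamma>)"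

definition covering_number :: "'a::euclidean_space set \<Rightarrow> real \<Rightarrow> nat" where
  "covering_number E \<epsilon> =
     (LEAST n. \<exists>A. finite A \<and> card A = n \<and> E \<subseteq> (\<Union>a\<in>A. cbox a (a + \<epsilon> *\<^sub>R One)))"

text \<open>Meaningful for bounded nonempty sets only.\<close>

definition upper_minkowski_dim :: "'a::euclidean_space set \<Rightarrow> ereal" where
  "upper_minkowski_dim E =
     Limsup (at_right 0) (\<lambda>\<epsilon>. ereal (ln (real (covering_number E \<epsilon>)) / ln (1 / \<epsilon>)))"

definition torus_graph :: "(real^'n \<Rightarrow> real) \<Rightarrow> ((real^'n) \<times> real) set" where
  "torus_graph g = (\<lambda>x. (x, g x)) ` cube"

definition graph_dim :: "(real^'n \<Rightarrow> complex) \<Rightarrow> ereal" where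
  "graph_dim v = max (upper_minkowski_dim (torus_graph (\<lambda>x. Re (v x))))
                     (upper_minkowski_dim (torus_graph (\<lambda>x. Im (v x))))"

end

theory Submission
  imports Defs
begin

text \<open>
  The block \<open>u\<^sub>N\<close> of \<open>u(\<cdot>,t)\<close> is the convolution of \<open>f\<^sub>N\<close> with a product of \<open>d\<close> one-dimensional
  quadratic Weyl sums of length about \<open>4N\<close>. Weyl differencing bounds the square of such a sum,
  uniformly in the space variable, by \<open>\<Sum>\<^bsub>h\<^esub> min(N, 1/\<bar>sin(ht)\<bar>)\<close>, whose integral over a period in \<open>t\<close>
  is \<open>O(N log N)\<close>; summing over dyadic \<open>N\<close> gives \<open>O(N\<^bsup>1/2+\<eta>\<^esup>)\<close> for the Weyl sums for almost every \<open>t\<close>.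
  With the \<open>L\<^sup>1\<close> hypothesis, \<open>u\<^sub>N\<close> is \<open>O(N\<^bsup>\<eta>-s\<^esup>)\<close> in the sup norm, and Abel summation gives the
  Lipschitz constant \<open>O(N\<^bsup>1+\<eta>-s\<^esup>)\<close>. Interpolating between the two and summing over \<open>N\<close> yields
  Hoelder continuity of every order below \<open>s\<close>, and a graph of a \<open>\<gamma>\<close>-Hoelder function is covered by
  \<open>O(\<epsilon>\<^bsup>-(d+1-\<gamma>)\<^esup>)\<close> boxes of side \<open>\<epsilon>\<close>.
\<close>

section \<open>Weyl sums\<close>

text \<open>Weyl differencing: in the expanded square the diagonal gives \<open>L\<close>, conjugate
  pairs combine to twice a real part, and the remaining pairs are grouped by their shift
  \<open>h\<close>. In the induction each shift gains exactly one pair, the one ending at the new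
  index.\<close>

lemma norm_sum_power2_correlations:
  fixes a :: "nat \<Rightarrow> complex"
  assumes "\<And>j. norm (a j) = 1"
  shows "(norm (\<Sum>j<L. a j))\<^sup>2 = real L + 2 * Re (\<Sum>h = 1..<L. \<Sum>k<L - h. a (k + h) * cnj (a k))"
proof (induction L)
  case 0
  then show ?case by simp
next
  case (Suc L)
  let ?S = "\<Sum>j<L. a j"
  have "(norm (?S + a L))\<^sup>2 = (norm ?S)\<^sup>2 + (norm (a L))\<^sup>2 + 2 * Re (a L * cnj ?S)"
    unfolding cmod_power2 by (simp add: power2_eq_square algebra_simps del: Re_sum Im_sum cnj_sum)
  also have "a L * cnj ?S = (\<Sum>j<L. a L * cnj (a j))"
    by (simp add: sum_distrib_left)
  also have "\<dots> = (\<Sum>h = 1..<Suc L. a L * cnj (a (L - h)))"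
    by (rule sum.reindex_bij_witness[of _ "\<lambda>h. L - h" "\<lambda>j. L - j"]) auto
  also have "(\<Sum>h = 1..<Suc L. \<Sum>k<Suc L - h. a (k + h) * cnj (a k))
      = (\<Sum>h = 1..<Suc L. (\<Sum>k<L - h. a (k + h) * cnj (a k)) + a L * cnj (a (L - h)))"
    by (intro sum.cong refl) (auto simp: Suc_diff_le)
  then have "(\<Sum>h = 1..<Suc L. a L * cnj (a (L - h)))
      = (\<Sum>h = 1..<Suc L. \<Sum>k<Suc L - h. a (k + h) * cnj (a k))
        - (\<Sum>h = 1..<Suc L. \<Sum>k<L - h. a (k + h) * cnj (a k))"
    by (simp only: sum.distrib) simp
  \<comment> \<open>At \<open>h = L\<close> the inner range is empty, so the old correlations stop
    at shift \<open>L - 1\<close>.\<close>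
  also have "(\<Sum>h = 1..<Suc L. \<Sum>k<L - h. a (k + h) * cnj (a k))
      = (\<Sum>h = 1..<L. \<Sum>k<L - h. a (k + h) * cnj (a k))"
    by (cases L) auto
  finally show ?case
    using Suc assms by simp
qed

text \<open>A geometric sum with ratio \<open>cis (2 * b)\<close>, for which the distance from the
  ratio to 1 is \<open>2 * \<bar>sin b\<bar>\<close>. The product form stays valid when the sine
  vanishes.\<close>

lemma norm_sum_cis_arith_le:
  "norm (\<Sum>k<M. cis (2 * b * real k + c)) * \<bar>sin b\<bar> \<le> 1"
proof -
  let ?z = "cis (2 * b)"
  have "(\<Sum>k<M. cis (2 * b * real k + c)) = cis c * (\<Sum>k<M. ?z ^ k)"
    unfolding sum_distrib_left
    by (rule sum.cong[OF refl]) (simp add: Complex.DeMoivre cis_mult algebra_simps)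
  then have "(\<Sum>k<M. cis (2 * b * real k + c)) * (?z - 1) = cis c * ((\<Sum>k<M. ?z ^ k) * (?z - 1))"
    by simp
  also have "(\<Sum>k<M. ?z ^ k) * (?z - 1) = ?z ^ M - 1"
    by (metis mult.commute power_diff_1_eq)
  finally have "norm (\<Sum>k<M. cis (2 * b * real k + c)) * norm (?z - 1) = norm (?z ^ M - 1)"
    by (metis mult.left_neutral norm_cis norm_mult)
  also have "\<dots> \<le> 2"
    using norm_triangle_ineq4[of "?z ^ M" 1] by (simp add: norm_power)
  also have "norm (?z - 1) = 2 * \<bar>sin b\<bar>"
    using dist_exp_i_1[of "2 * b"] by (simp add: cis_conv_exp)
  finally show ?thesis by simp
qed

text \<open>
  Up to a constant the summand is \<open>min(H, 1/\<bar>sin(ht)\<bar>)\<close>; this form is continuous in \<open>t\<close> and has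
  an explicitly computable integral bound.
\<close>

definition weyl_majorant :: "nat \<Rightarrow> real \<Rightarrow> real" where
  "weyl_majorant H t = real H + 4 * (\<Sum>h = 1..H. 1 / (1 / real H + \<bar>sin (real h * t)\<bar>))"

lemma weyl_majorant_pos: "0 < H \<Longrightarrow> 0 < weyl_majorant H t"
  unfolding weyl_majorant_def by (intro add_pos_nonneg mult_nonneg_nonneg sum_nonneg) auto

text \<open>Since \<open>(k + h)^2 - k^2\<close> is linear in \<open>k\<close>, each correlation of
  the quadratic phase is a geometric sum with ratio \<open>cis (2 * h * t)\<close>. The variable
  \<open>y\<close> enters only through a constant phase, hence the uniformity in
  \<open>y\<close>.\<close>

lemma weyl_inequality:
  assumes "L \<le> H"
  shows "(norm (\<Sum>j<L. cis ((real j)\<^sup>2 * t + real j * y)))\<^sup>2 \<le> weyl_majorant H t"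
proof (cases "H = 0")
  case True
  then show ?thesis using assms by (simp add: weyl_majorant_def)
next
  case False
  let ?a = "\<lambda>j. cis ((real j)\<^sup>2 * t + real j * y)"
  define c where "c h = (\<Sum>k<L - h. ?a (k + h) * cnj (?a k))" for h
  have c: "norm (c h) \<le> 2 / (1 / real H + \<bar>sin (real h * t)\<bar>)" for h
  proof -
    have "c h = (\<Sum>k<L - h. cis (2 * (real h * t) * real k + ((real h)\<^sup>2 * t + real h * y)))"
      unfolding c_def cis_cnj cis_mult
      by (intro sum.cong refl arg_cong[where f = cis]) (simp add: power2_eq_square algebra_simps)
    then have sin: "norm (c h) * \<bar>sin (real h * t)\<bar> \<le> 1"
      using norm_sum_cis_arith_le[of "real h * t" "(real h)\<^sup>2 * t + real h * y" "L - h"]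
      by (simp only:)
    have "norm (c h) \<le> (\<Sum>k<L - h. 1)"
      unfolding c_def by (intro sum_norm_le) (simp add: norm_mult)
    also have "\<dots> \<le> real H"
      using assms by simp
    finally have "norm (c h) * (1 / real H) \<le> 1"
      using False by (simp add: field_simps)
    \<comment> \<open>Adding the trivial and the geometric bound replaces the minimum of the two by
      one fraction whose denominator never vanishes.\<close>
    with sin have "norm (c h) * (1 / real H + \<bar>sin (real h * t)\<bar>) \<le> 2"
      by (simp only: distrib_left)
    moreover have "1 / real H + \<bar>sin (real h * t)\<bar> > 0"
      using False by (intro add_pos_nonneg) auto
    ultimately show ?thesis
      by (simp add: pos_le_divide_eq)
  qed
  have "(norm (\<Sum>j<L. ?a j))\<^sup>2 = real L + 2 * Re (\<Sum>h = 1..<L. c h)"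
    unfolding c_def by (rule norm_sum_power2_correlations) simp
  also have "Re (\<Sum>h = 1..<L. c h) \<le> (\<Sum>h = 1..<L. norm (c h))"
    by (rule order_trans[OF complex_Re_le_cmod norm_sum])
  also have "\<dots> \<le> (\<Sum>h = 1..<L. 2 / (1 / real H + \<bar>sin (real h * t)\<bar>))"
    by (intro sum_mono c)
  also have "\<dots> \<le> (\<Sum>h = 1..H. 2 / (1 / real H + \<bar>sin (real h * t)\<bar>))"
    using assms by (intro sum_mono2) auto
  also have "\<dots> = 2 * (\<Sum>h = 1..H. 1 / (1 / real H + \<bar>sin (real h * t)\<bar>))"
    by (simp add: sum_distrib_left)
  finally show ?thesis
    using assms by (simp add: weyl_majorant_def)
qed

text \<open>Summation by parts: cancellation in the partial sums of \<open>e\<close> survives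
  multiplication by \<open>a\<close>, at the cost of the last value and the total variation of
  \<open>a\<close>.\<close>

lemma abel_summation_le:
  fixes a e :: "nat \<Rightarrow> complex"
  assumes "\<And>L. L \<le> Suc n \<Longrightarrow> norm (\<Sum>j<L. e j) \<le> B"
  shows "norm (\<Sum>j<Suc n. a j * e j) \<le> B * (norm (a n) + (\<Sum>j<n. norm (a (Suc j) - a j)))"
proof -
  have parts: "(\<Sum>j<Suc m. a j * e j)
      = a m * (\<Sum>j<Suc m. e j) - (\<Sum>j<m. (a (Suc j) - a j) * (\<Sum>i<Suc j. e i))" for m
    by (induction m) (auto simp: algebra_simps)
  have "norm (\<Sum>j<Suc n. a j * e j) \<le> norm (a n) * norm (\<Sum>j<Suc n. e j)
      + (\<Sum>j<n. norm (a (Suc j) - a j) * norm (\<Sum>i<Suc j. e i))"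
    unfolding parts norm_mult[symmetric]
    by (rule order_trans[OF norm_triangle_ineq4 add_left_mono[OF norm_sum]])
  also have "\<dots> \<le> norm (a n) * B + (\<Sum>j<n. norm (a (Suc j) - a j) * B)"
    by (intro add_mono sum_mono mult_left_mono assms) auto
  finally show ?thesis
    by (simp add: sum_distrib_left sum_distrib_right algebra_simps)
qed

section \<open>The one-dimensional Schroedinger kernel: size and Lipschitz constant\<close>

lemma norm_cis_diff_le: "norm (cis a - cis b) \<le> \<bar>a - b\<bar>"
proof -
  have "cis a - cis b = cis b * (cis (a - b) - 1)"
    by (simp add: algebra_simps cis_mult)
  then have "norm (cis a - cis b) = norm (exp (\<i> * of_real (a - b)) - 1)"
    by (simp add: norm_mult cis_conv_exp)
  also have "\<dots> \<le> \<bar>a - b\<bar>"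
    unfolding dist_exp_i_1 using abs_sin_x_le_abs_x[of "(a - b) / 2"] by simp
  finally show ?thesis .
qed

text \<open>The Dirichlet kernel of order \<open>M\<close> evolved to time \<open>t\<close>.\<close>

definition schrodinger_sum :: "nat \<Rightarrow> real \<Rightarrow> real \<Rightarrow> complex" where
  "schrodinger_sum M t x = (\<Sum>n\<in>{- int M..int M}. cis ((of_int n)\<^sup>2 * t + of_int n * x))"

lemma sum_int_symmetric_interval:
  "(\<Sum>n\<in>{- int M..int M}. g n) = (\<Sum>j<Suc (2 * M). g (int j - int M))"
  by (rule sum.reindex_bij_witness[of _ "\<lambda>j. int j - int M" "\<lambda>n. nat (n + int M)"]) auto

text \<open>Recentring the index at \<open>M\<close> only changes the linear phase to
  \<open>x - 2 * M * t\<close> and adds a constant phase, which the uniform Weyl inequality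
  tolerates.\<close>

lemma norm_schrodinger_partial_sum:
  assumes "L \<le> H"
  shows "norm (\<Sum>j<L. cis ((real j - real M)\<^sup>2 * t + (real j - real M) * x))
    \<le> sqrt (weyl_majorant H t)"
proof -
  have "(\<Sum>j<L. cis ((real j - real M)\<^sup>2 * t + (real j - real M) * x))
      = cis ((real M)\<^sup>2 * t - real M * x)
        * (\<Sum>j<L. cis ((real j)\<^sup>2 * t + real j * (x - 2 * real M * t)))"
    by (simp add: sum_distrib_left cis_mult) (simp add: power2_eq_square algebra_simps)
  then show ?thesis
    using weyl_inequality[OF assms] by (simp add: norm_mult real_le_rsqrt)
qed

lemma norm_schrodinger_sum_le:
  assumes "2 * M < H"
  shows "norm (schrodinger_sum M t x) \<le> sqrt (weyl_majorant H t)"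
  unfolding schrodinger_sum_def sum_int_symmetric_interval
  using norm_schrodinger_partial_sum[of "Suc (2 * M)" H M t x] assms by simp

text \<open>Abel summation keeps the Weyl cancellation, where a termwise estimate would cost order
  \<open>M^2\<close>. The factor \<open>3 * M\<close> is \<open>M\<close> from the last value of
  \<open>a\<close> plus \<open>2 * M\<close> increments of size at most
  \<open>\<bar>x - y\<bar>\<close>.\<close>

lemma norm_schrodinger_sum_diff_le:
  assumes "2 * M < H"
  shows "norm (schrodinger_sum M t x - schrodinger_sum M t y)
    \<le> sqrt (weyl_majorant H t) * (3 * real M * \<bar>x - y\<bar>)"
proof -
  define a where "a j = cis ((real j - real M) * (x - y)) - 1" for j
  define e where "e j = cis ((real j - real M)\<^sup>2 * t + (real j - real M) * y)" for j
  have "schrodinger_sum M t x - schrodinger_sum M t y = (\<Sum>j<Suc (2 * M). a j * e j)"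
    unfolding schrodinger_sum_def sum_int_symmetric_interval sum_subtractf[symmetric]
    by (intro sum.cong refl) (simp add: a_def e_def cis_mult algebra_simps)
  also have "norm \<dots> \<le> sqrt (weyl_majorant H t)
      * (norm (a (2 * M)) + (\<Sum>j<2 * M. norm (a (Suc j) - a j)))"
    unfolding e_def using assms
    by (intro abel_summation_le norm_schrodinger_partial_sum) simp
  also have "\<dots> \<le> sqrt (weyl_majorant H t) * (real M * \<bar>x - y\<bar> + (\<Sum>j<2 * M. \<bar>x - y\<bar>))"
  proof (intro mult_left_mono add_mono sum_mono)
    show "norm (a (2 * M)) \<le> real M * \<bar>x - y\<bar>"
      using norm_cis_diff_le[of "real M * (x - y)" 0] by (simp add: a_def abs_mult)
    show "norm (a (Suc j) - a j) \<le> \<bar>x - y\<bar>" for j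
      using norm_cis_diff_le[of "(1 + real j - real M) * (x - y)" "(real j - real M) * (x - y)"]
      by (simp add: a_def algebra_simps)
    show "0 \<le> sqrt (weyl_majorant H t)"
      using weyl_majorant_pos[of H t] assms by simp
  qed
  finally show ?thesis
    by (simp add: algebra_simps)
qed

section \<open>Integration in time\<close>

lemma periodic_shift_int:
  fixes g :: "real \<Rightarrow> 'a"
  assumes "\<And>u. g (u + p) = g u"
  shows "g (u + of_int k * p) = g u"
proof (induction k rule: int_induct[where k = 0])
  case (step1 i)
  then show ?case
    using assms[of "u + of_int i * p"] by (simp add: algebra_simps)
next
  case (step2 i)
  then show ?case
    using assms[of "u + of_int (i - 1) * p"] by (simp add: algebra_simps)
qed simp

text \<open>Each induction step attaches one period at either end. Symmetric intervals are used
  because they exhaust the line.\<close>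

lemma has_integral_periodic:
  fixes g :: "real \<Rightarrow> real"
  assumes g: "(g has_integral I) {0..p}" and per: "\<And>u. g (u + p) = g u" and "0 \<le> p"
  shows "(g has_integral (2 * real n * I)) {- (real n * p)..real n * p}"
proof (induction n)
  case 0
  show ?case
    using has_integral_refl(2)[of g 0] by simp
next
  case (Suc n)
  have piece: "(g has_integral I) {of_int k * p..(of_int k + 1) * p}" for k
    using has_integral_affinity'[of g I 0 p 1 "of_int (- k) * p"] g periodic_shift_int[where g = g and p = p and k = "- k", OF per]
    by (simp add: algebra_simps)
  have "(g has_integral (I + 2 * real n * I)) {- (real (Suc n) * p)..real n * p}"
    using piece[of "- int (Suc n)"] \<open>0 \<le> p\<close>
    by (intro has_integral_combine[OF _ _ _ Suc]) (auto simp: algebra_simps)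
  then have "(g has_integral (I + 2 * real n * I + I)) {- (real (Suc n) * p)..real (Suc n) * p}"
    using piece[of "int n"] \<open>0 \<le> p\<close>
    by (elim has_integral_combine[rotated 2])
       (auto simp: algebra_simps intro: order_trans[of _ 0] add_nonneg_nonneg)
  then show ?case
    by (simp add: algebra_simps)
qed

text \<open>Jordan's inequality: a concave function lies above its chord.\<close>

lemma sin_ge_linear:
  assumes "0 \<le> u" "u \<le> pi / 2"
  shows "2 * u / pi \<le> sin u"
proof -
  have "concave_on {0..pi / 2} sin"
    by (rule f''_le0_imp_concave[where f' = cos and f'' = "\<lambda>x. - sin x"])
       (auto intro!: derivative_eq_intros sin_ge_zero)
  from concave_onD_Icc'[OF this, of u] show ?thesis
    using assms by (simp add: field_simps)
qed

text \<open>Jordan's inequality at 0 and, reflected, at \<open>pi\<close> bounds the integrand by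
  one summand of \<open>?h\<close> on each half. Taking both summands on the whole interval gives
  the single primitive \<open>?H\<close>.\<close>

lemma integral_inverse_sin_le:
  assumes "0 < a"
  shows "integral {0..pi} (\<lambda>u. 1 / (a + \<bar>sin u\<bar>)) \<le> pi * ln (1 + 2 / a)"
proof -
  let ?h = "\<lambda>u. 1 / (a + 2 * u / pi) + 1 / (a + 2 * (pi - u) / pi)"
  let ?H = "\<lambda>u. pi / 2 * ln (a + 2 * u / pi) - pi / 2 * ln (a + 2 * (pi - u) / pi)"
  have h: "(?h has_integral (?H pi - ?H 0)) {0..pi}"
  proof (rule fundamental_theorem_of_calculus)
    fix u assume "u \<in> {0..pi}"
    then have pos: "a + 2 * u / pi > 0" "a + 2 * (pi - u) / pi > 0"
      using assms by (auto intro!: add_pos_nonneg)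
    have ln_deriv: "((\<lambda>u. pi / 2 * ln (g u)) has_real_derivative D * pi / 2 * (1 / g u))
        (at u within {0..pi})"
      if "(g has_real_derivative D) (at u within {0..pi})" "0 < g u" for g D
      using DERIV_cmult[OF DERIV_chain2[OF DERIV_ln_divide[OF that(2)] that(1)], of "pi / 2"]
      by (simp add: mult_ac)
    have "((\<lambda>u. a + 2 * u / pi) has_real_derivative 2 / pi) (at u within {0..pi})"
      and "((\<lambda>u. a + 2 * (pi - u) / pi) has_real_derivative - 2 / pi) (at u within {0..pi})"
      by (auto intro!: derivative_eq_intros)
    from this[THEN ln_deriv] pos
    have "((\<lambda>u. pi / 2 * ln (a + 2 * u / pi)) has_real_derivative 1 / (a + 2 * u / pi))
          (at u within {0..pi})"
        and "((\<lambda>u. pi / 2 * ln (a + 2 * (pi - u) / pi)) has_real_derivative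
          - (1 / (a + 2 * (pi - u) / pi))) (at u within {0..pi})"
      by simp_all
    from DERIV_diff[OF this] have "(?H has_real_derivative ?h u) (at u within {0..pi})"
      by simp
    then show "(?H has_vector_derivative ?h u) (at u within {0..pi})"
      by (simp add: has_real_derivative_iff_has_vector_derivative)
  qed simp
  have le: "1 / (a + \<bar>sin u\<bar>) \<le> ?h u" if "u \<in> {0..pi}" for u
  proof (cases "u \<le> pi / 2")
    case True
    then have "1 / (a + \<bar>sin u\<bar>) \<le> 1 / (a + 2 * u / pi)"
      using that sin_ge_linear[of u] sin_ge_zero[of u] assms
      by (intro divide_left_mono mult_pos_pos add_pos_nonneg) auto
    moreover have "0 \<le> 1 / (a + 2 * (pi - u) / pi)"
      using that assms by auto
    ultimately show ?thesis by linarith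
  next
    case False
    then have "1 / (a + \<bar>sin u\<bar>) \<le> 1 / (a + 2 * (pi - u) / pi)"
      using that sin_ge_linear[of "pi - u"] sin_ge_zero[of u] assms
      by (intro divide_left_mono mult_pos_pos add_pos_nonneg) auto
    moreover have "0 \<le> 1 / (a + 2 * u / pi)"
      using that assms by auto
    ultimately show ?thesis by linarith
  qed
  have "(\<lambda>u. 1 / (a + \<bar>sin u\<bar>)) integrable_on {0..pi}"
    using assms
    by (intro integrable_continuous_interval continuous_intros) (auto simp: add_nonneg_eq_0_iff)
  from integral_le[OF this has_integral_integrable[OF h] le]
  have "integral {0..pi} (\<lambda>u. 1 / (a + \<bar>sin u\<bar>)) \<le> ?H pi - ?H 0"
    unfolding integral_unique[OF h] .
  also have "\<dots> = pi * (ln (a + 2) - ln a)"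
    using pi_neq_zero by (simp add: algebra_simps)
  also have "ln (a + 2) - ln a = ln (1 + 2 / a)"
    using assms ln_div[of "a + 2" a] by (simp add: add_divide_distrib)
  finally show ?thesis .
qed

text \<open>The substitution \<open>u = h * t\<close> produces \<open>h\<close> times as many
  periods and a Jacobian \<open>1 / h\<close>, so the value does not depend on
  \<open>h\<close>.\<close>

lemma has_integral_inverse_sin_multiple:
  assumes "0 < a" "1 \<le> h"
  shows "((\<lambda>t. 1 / (a + \<bar>sin (real h * t)\<bar>)) has_integral
     2 * real n * integral {0..pi} (\<lambda>u. 1 / (a + \<bar>sin u\<bar>))) {- (real n * pi)..real n * pi}"
proof -
  let ?g = "\<lambda>u. 1 / (a + \<bar>sin u\<bar>)"
  have "(?g has_integral integral {0..pi} ?g) {0..pi}"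
    using assms
    by (intro integrable_integral integrable_continuous_interval continuous_intros)
       (auto simp: add_nonneg_eq_0_iff)
  then have "(?g has_integral (2 * real (n * h) * integral {0..pi} ?g))
      (cbox (- (real (n * h) * pi)) (real (n * h) * pi))"
    unfolding cbox_interval by (rule has_integral_periodic) auto
  from has_integral_affinity'[OF this, of "real h" 0]
  have "((\<lambda>t. ?g (real h * t)) has_integral
      inverse (real h) * (2 * real (n * h) * integral {0..pi} ?g))
      {inverse (real h) * - (real (n * h) * pi)..inverse (real h) * (real (n * h) * pi)}"
    using assms by simp
  moreover have "inverse (real h) * (2 * real (n * h) * x) = 2 * real n * x"
    "inverse (real h) * - (real (n * h) * x) = - (real n * x)"
    "inverse (real h) * (real (n * h) * x) = real n * x" for x
    using assms by simp_all
  ultimately show ?thesis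
    by (simp only:)
qed

text \<open>Each of the \<open>H\<close> shifts contributes the same logarithm, so the mean over
  time is of order \<open>H * ln H\<close> against the trivial \<open>H^2\<close>: square-root
  cancellation on average.\<close>

lemma integral_weyl_majorant_le:
  assumes "1 \<le> H"
  shows "\<exists>I \<le> 2 * real n * pi * real H * (1 + 4 * ln (1 + 2 * real H)).
    (weyl_majorant H has_integral I) {- (real n * pi)..real n * pi}"
proof -
  let ?J = "integral {0..pi} (\<lambda>u. 1 / (1 / real H + \<bar>sin u\<bar>))"
  let ?I = "real H * (2 * real n * pi) + 4 * (\<Sum>h = 1..H. 2 * real n * ?J)"
  have c: "((\<lambda>t. real H) has_integral real H * (2 * real n * pi)) {- (real n * pi)..real n * pi}"
    using has_integral_const_real[of "real H" "- (real n * pi)" "real n * pi"]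
    by (simp add: mult_ac)
  have "(weyl_majorant H has_integral ?I) {- (real n * pi)..real n * pi}"
    unfolding weyl_majorant_def[abs_def]
    by (intro has_integral_add[OF c] has_integral_mult_right has_integral_sum
          has_integral_inverse_sin_multiple) (use assms in auto)
  moreover have "?J \<le> pi * ln (1 + 2 * real H)"
    using integral_inverse_sin_le[of "1 / real H"] assms by simp
  then have "2 * real n * ?J \<le> 2 * real n * (pi * ln (1 + 2 * real H))"
    by (intro mult_left_mono) auto
  then have "?I \<le> real H * (2 * real n * pi)
      + 4 * (\<Sum>h = 1..H. 2 * real n * (pi * ln (1 + 2 * real H)))"
    by (intro add_left_mono mult_left_mono[of _ _ 4] sum_mono) auto
  then have "?I \<le> 2 * real n * pi * real H * (1 + 4 * ln (1 + 2 * real H))"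
    by (simp add: algebra_simps)
  ultimately show ?thesis by blast
qed

text \<open>By monotone convergence the sum of all \<open>F k\<close> has finite integral over
  \<open>S\<close>, so it is finite almost everywhere there, and it dominates each of its
  nonnegative terms.\<close>

lemma AE_bounded_if_summable_integrals:
  fixes F :: "nat \<Rightarrow> 'a::euclidean_space \<Rightarrow> real"
  assumes nn: "\<And>k t. 0 \<le> F k t" and meas: "\<And>k. F k \<in> borel_measurable borel"
    and S: "S \<in> sets borel" and I: "\<And>k. (F k has_integral I k) S" and sum: "summable I"
  shows "AE t in lborel. t \<in> S \<longrightarrow> (\<exists>B. \<forall>k. F k t \<le> B)"
proof -
  let ?G = "\<lambda>t. \<Sum>k. ennreal (F k t) * indicator S t"
  have Inn: "0 \<le> I k" for k
    by (rule has_integral_nonneg[OF I nn])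
  have "(\<integral>\<^sup>+t. ?G t \<partial>lborel) = (\<Sum>k. \<integral>\<^sup>+t. ennreal (F k t) * indicator S t \<partial>lborel)"
    using meas S by (intro nn_integral_suminf) auto
  also have "\<dots> = (\<Sum>k. ennreal (I k))"
    using nn_integral_has_integral_lebesgue'[OF nn I] by simp
  also have "\<dots> = ennreal (suminf I)"
    by (rule suminf_ennreal2[OF Inn sum])
  finally have "AE t in lborel. ?G t \<noteq> \<infinity>"
    using meas S by (intro nn_integral_PInf_AE) auto
  then show ?thesis
  proof eventually_elim
    case (elim t)
    show ?case
    proof
      assume "t \<in> S"
      have "F k t \<le> enn2real (?G t)" for k
      proof -
        have "ennreal (F k t) = (\<Sum>j\<in>{k}. ennreal (F j t) * indicator S t)"
          using \<open>t \<in> S\<close> by simp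
        also have "\<dots> \<le> ?G t"
          by (rule sum_le_suminf) auto
        finally show ?thesis
          using elim nn[of k t] enn2real_mono[of "ennreal (F k t)" "?G t"]
          by (simp add: less_top)
      qed
      then show "\<exists>B. \<forall>k. F k t \<le> B" by blast
    qed
  qed
qed

section \<open>Power bounds for the Weyl majorant at almost every time\<close>

lemma weyl_majorant_nonneg: "0 \<le> weyl_majorant H t"
  unfolding weyl_majorant_def by (intro add_nonneg_nonneg mult_nonneg_nonneg sum_nonneg) auto

lemma weyl_majorant_measurable: "weyl_majorant H \<in> borel_measurable borel"
  unfolding weyl_majorant_def[abs_def] by measurable

text \<open>Absorbs the logarithm into a small power. The argument \<open>10 * x\<close> is
  \<open>2 * H\<close> for \<open>H = 5 * 2 ^ k\<close> and \<open>x = 2 ^ k\<close>.\<close>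

lemma one_add_ln_le_powr:
  fixes x \<delta> :: real
  assumes "1 \<le> x" "0 < \<delta>"
  shows "1 + 4 * ln (1 + 10 * x) \<le> (1 + 4 * 11 powr \<delta> / \<delta>) * x powr \<delta>"
proof -
  have "ln (1 + 10 * x) \<le> ln (11 * x)"
    using assms by (subst ln_le_cancel_iff) auto
  also have "\<dots> \<le> (11 * x) powr \<delta> / \<delta>"
    using assms by (intro ln_powr_bound) auto
  also have "(11 * x) powr \<delta> = 11 powr \<delta> * x powr \<delta>"
    by (simp add: powr_mult)
  finally have "4 * ln (1 + 10 * x) \<le> 4 * (11 powr \<delta> * x powr \<delta> / \<delta>)" by simp
  moreover have "1 \<le> x powr \<delta>"
    using assms by (simp add: ge_one_powr_ge_zero)
  moreover have "(1 + 4 * 11 powr \<delta> / \<delta>) * x powr \<delta>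
      = x powr \<delta> + 4 * (11 powr \<delta> * x powr \<delta> / \<delta>)"
    by (simp add: distrib_right)
  ultimately show ?thesis
    by linarith
qed

lemma power_powr_commute: "(x ^ k) powr a = ((x::real) powr a) ^ k"
  by (induction k) (auto simp: powr_mult)

text \<open>After weighting by \<open>c k\<close> the integrals decay geometrically, so almost every
  time has one bound for all dyadic lengths. The factor 5 leaves room for the
  \<open>4 * 2 ^ k + 1\<close> terms of the kernel of the \<open>k\<close>-th block.\<close>

lemma AE_weyl_majorant_dyadic_bound:
  assumes "0 < \<delta>"
  shows "AE t in lborel. \<exists>B. \<forall>k. weyl_majorant (5 * 2 ^ k) t \<le> B * (2 ^ k) powr (1 + \<delta>)"
proof -
  define c where "c k = ((2::real) ^ k) powr (- (1 + \<delta>))" for k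
  have c_pos: "0 < c k" for k by (simp add: c_def)
  have c_inv: "c k * (2 ^ k) powr (1 + \<delta>) = 1" for k
    unfolding c_def by (simp flip: powr_add)
  have on_interval: "AE t in lborel. t \<in> {- (real n * pi)..real n * pi} \<longrightarrow>
      (\<exists>B. \<forall>k. c k * weyl_majorant (5 * 2 ^ k) t \<le> B)" for n
  proof -
    \<comment> \<open>Half of \<open>\<delta>\<close> pays for the logarithm; the other half makes
      the weighted integrals summable.\<close>
    define X where "X = 1 + 4 * 11 powr (\<delta> / 2) / (\<delta> / 2)"
    define A where "A = 10 * real n * pi * X"
    have "\<exists>I. (weyl_majorant (5 * 2 ^ k) has_integral I) {- (real n * pi)..real n * pi}
        \<and> I \<le> A * (2 ^ k * (2 ^ k) powr (\<delta> / 2))" for k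
    proof -
      obtain I where I: "(weyl_majorant (5 * 2 ^ k) has_integral I) {- (real n * pi)..real n * pi}"
        "I \<le> 2 * real n * pi * real (5 * 2 ^ k) * (1 + 4 * ln (1 + 2 * real (5 * 2 ^ k)))"
        using integral_weyl_majorant_le[of "5 * 2 ^ k" n] by auto
      note I(2)
      also have "1 + 4 * ln (1 + 2 * real (5 * 2 ^ k))
          \<le> X * (2 ^ k) powr (\<delta> / 2)"
        unfolding X_def using one_add_ln_le_powr[of "2 ^ k" "\<delta> / 2"] assms by simp
      finally have "I \<le> 2 * real n * pi * real (5 * 2 ^ k)
          * (X * (2 ^ k) powr (\<delta> / 2))"
        by (simp add: mult_left_mono)
      then have "I \<le> A * (2 ^ k * (2 ^ k) powr (\<delta> / 2))"
        by (simp add: A_def mult_ac)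
      with I(1) show ?thesis by blast
    qed
    then obtain I where I: "(weyl_majorant (5 * 2 ^ k) has_integral I k) {- (real n * pi)..real n * pi}"
      and I_le: "I k \<le> A * (2 ^ k * (2 ^ k) powr (\<delta> / 2))" for k
      by metis
    have "c k * I k \<le> A * (2 powr (- \<delta> / 2)) ^ k" for k
    proof -
      have "c k * I k \<le> c k * (A * (2 ^ k * (2 ^ k) powr (\<delta> / 2)))"
        by (intro mult_left_mono I_le less_imp_le c_pos)
      also have "\<dots> = A * ((2 ^ k) powr (- (1 + \<delta>)) * ((2 ^ k) powr 1 * (2 ^ k) powr (\<delta> / 2)))"
        unfolding c_def by (simp add: mult_ac)
      also have "(2 ^ k) powr (- (1 + \<delta>)) * ((2 ^ k) powr 1 * (2 ^ k) powr (\<delta> / 2))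
          = ((2::real) ^ k) powr (- \<delta> / 2)"
        by (simp only: powr_add[symmetric]) simp
      also have "\<dots> = (2 powr (- \<delta> / 2)) ^ k"
        by (rule power_powr_commute)
      finally show ?thesis .
    qed
    moreover have "0 \<le> c k * I k" for k
      using has_integral_nonneg[OF I weyl_majorant_nonneg] c_pos[of k] by simp
    moreover have "summable (\<lambda>k. A * (2 powr (- \<delta> / 2)) ^ k)"
      using assms by (intro summable_mult summable_geometric) (auto simp: powr_less_one)
    ultimately have "summable (\<lambda>k. c k * I k)"
      by - (rule summable_comparison_test'[where N = 0], assumption, simp)
    with I show ?thesis
      by (intro AE_bounded_if_summable_integrals[where I = "\<lambda>k. c k * I k"]
            has_integral_mult_right mult_nonneg_nonneg weyl_majorant_nonneg less_imp_le[OF c_pos]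
            borel_measurable_times borel_measurable_const weyl_majorant_measurable) simp_all
  qed
  \<comment> \<open>Countably many null sets are merged, since the intervals cover the line.\<close>
  have "AE t in lborel. \<forall>n. t \<in> {- (real n * pi)..real n * pi} \<longrightarrow>
      (\<exists>B. \<forall>k. c k * weyl_majorant (5 * 2 ^ k) t \<le> B)"
    unfolding AE_all_countable using on_interval by blast
  then show ?thesis
  proof eventually_elim
    case (elim t)
    obtain n where "\<bar>t\<bar> / pi \<le> real n"
      using real_arch_simple by blast
    then have "t \<in> {- (real n * pi)..real n * pi}"
      by (auto simp: field_simps)
    with elim obtain B where B: "c k * weyl_majorant (5 * 2 ^ k) t \<le> B" for k
      by blast
    have "weyl_majorant (5 * 2 ^ k) t \<le> B * (2 ^ k) powr (1 + \<delta>)" for k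
    proof -
      have "weyl_majorant (5 * 2 ^ k) t = c k * weyl_majorant (5 * 2 ^ k) t * (2 ^ k) powr (1 + \<delta>)"
        using c_inv[of k] by (simp add: mult_ac)
      also have "\<dots> \<le> B * (2 ^ k) powr (1 + \<delta>)"
        by (intro mult_right_mono B) auto
      finally show ?thesis .
    qed
    then show ?case by blast
  qed
qed

section \<open>Trigonometric polynomials on the torus\<close>

lemma cis_sum: "cis (\<Sum>i\<in>A. f i) = (\<Prod>i\<in>A. cis (f i))"
  by (induction A rule: infinite_finite_induct) (auto simp flip: cis_mult)

text \<open>Fubini for a product of one-variable functions. Each factor is cut off to its interval
  as \<open>G\<close>, so that the box disappears and \<open>lborel\<close> can be replaced by the
  product measure.\<close>

lemma integral_cbox_prod:
  fixes a b :: "'a::euclidean_space" and g :: "'a \<Rightarrow> real \<Rightarrow> complex"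
  assumes cont: "\<And>j. continuous_on UNIV (g j)" and le: "\<And>j. j \<in> Basis \<Longrightarrow> a \<bullet> j \<le> b \<bullet> j"
  shows "(LINT x|lebesgue_on (cbox a b). (\<Prod>j\<in>Basis. g j (x \<bullet> j)))
    = (\<Prod>j\<in>Basis. integral {a \<bullet> j..b \<bullet> j} (g j))"
proof -
  interpret product_sigma_finite "\<lambda>_::'a. lborel :: real measure"
    by standard
  define G where "G j t = indicator {a \<bullet> j..b \<bullet> j} t *\<^sub>R g j t" for j t
  have G_int: "integrable lborel (G j)" for j
    unfolding G_def using cont by (intro borel_integrable_compact) (auto intro: continuous_on_subset)
  then have G_meas[measurable]: "G j \<in> borel_measurable borel" for j
    using borel_measurable_integrable by force
  have ind: "indicator (cbox a b) x *\<^sub>R (\<Prod>j\<in>Basis. g j (x \<bullet> j)) = (\<Prod>j\<in>Basis. G j (x \<bullet> j))" for x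
  proof (cases "x \<in> cbox a b")
    case True
    then show ?thesis
      by (auto simp: G_def mem_box intro!: prod.cong)
  next
    case False
    then obtain j where "j \<in> Basis" "x \<bullet> j \<notin> {a \<bullet> j..b \<bullet> j}"
      by (auto simp: mem_box)
    then have "G j (x \<bullet> j) = 0"
      by (auto simp: G_def)
    with \<open>j \<in> Basis\<close> have "(\<Prod>j\<in>Basis. G j (x \<bullet> j)) = 0"
      by (auto simp: prod_zero_iff)
    then show ?thesis
      using False by simp
  qed
  have "(LINT x|lebesgue_on (cbox a b). (\<Prod>j\<in>Basis. g j (x \<bullet> j)))
      = (LINT x|lebesgue. (\<Prod>j\<in>Basis. G j (x \<bullet> j)))"
    by (subst integral_restrict_space) (auto simp: ind)
  also have "\<dots> = (LINT x|lborel. (\<Prod>j\<in>Basis. G j (x \<bullet> j)))"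
    by (rule integral_completion) measurable
  also have "\<dots> = (LINT f|(\<Pi>\<^sub>M b\<in>Basis. lborel). (\<Prod>j\<in>Basis. G j ((\<Sum>b\<in>Basis. f b *\<^sub>R b) \<bullet> j)))"
    by (subst lborel_eq) (rule integral_distr; measurable)
  also have "\<dots> = (LINT f|(\<Pi>\<^sub>M b\<in>(Basis :: 'a set). lborel). (\<Prod>j\<in>Basis. G j (f j)))"
    by (intro Bochner_Integration.integral_cong refl prod.cong) simp_all
  also have "\<dots> = (\<Prod>j\<in>Basis. LINT t|lborel. G j t)"
    by (rule product_integral_prod) (auto intro: G_int)
  also have "\<dots> = (\<Prod>j\<in>Basis. integral {a \<bullet> j..b \<bullet> j} (g j))"
  proof (rule prod.cong[OF refl])
    fix j
    show "(LINT t|lborel. G j t) = integral {a \<bullet> j..b \<bullet> j} (g j)"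
      using set_borel_integral_eq_integral(2)[of "{a \<bullet> j..b \<bullet> j}" "g j"] G_int[of j]
      by (simp add: G_def[abs_def] set_integrable_def set_lebesgue_integral_def)
  qed
  finally show ?thesis .
qed

lemma integral_cis_period:
  "integral {0..2 * pi} (\<lambda>t. cis (of_int k * t)) = (if k = 0 then 2 * of_real pi else 0)"
proof (cases "k = 0")
  case True
  then show ?thesis by (simp add: scaleR_conv_of_real)
next
  case False
  have "((\<lambda>t. cis (of_int k * t)) has_integral
      cis (of_int k * (2 * pi)) / (\<i> * of_int k) - cis (of_int k * 0) / (\<i> * of_int k)) {0..2 * pi}"
  proof (rule fundamental_theorem_of_calculus)
    fix t
    show "((\<lambda>t. cis (of_int k * t) / (\<i> * of_int k)) has_vector_derivative cis (of_int k * t))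
        (at t within {0..2 * pi})"
    proof -
      have "((\<lambda>z. exp (\<i> * of_int k * z) / (\<i> * of_int k)) has_field_derivative
          exp (\<i> * of_int k * of_real t)) (at (of_real t))"
        using False by (auto intro!: derivative_eq_intros)
      from has_vector_derivative_real_field[OF this] show ?thesis
        by (simp add: cis_conv_exp mult.assoc)
    qed
  qed simp
  moreover have "cis (of_int k * (2 * pi)) = 1"
    using cis_multiple_2pi[of "of_int k"] by (simp add: mult_ac)
  ultimately have "((\<lambda>t. cis (of_int k * t)) has_integral 0) {0..2 * pi}"
    by simp
  with False show ?thesis
    by (simp add: integral_unique)
qed

section \<open>Characters of the torus and their orthogonality\<close>

lemma freq_dot_inner: "freq_dot m x = (\<chi> i. real_of_int (m $ i)) \<bullet> x"
  by (simp add: freq_dot_def inner_vec_def)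

lemma continuous_on_cis_freq_dot: "continuous_on A (\<lambda>x. cis (freq_dot m x))"
  unfolding freq_dot_inner by (intro continuous_intros)

lemma prod_Basis_vec: "(\<Prod>j\<in>(Basis :: (real^'n) set). h j) = (\<Prod>i\<in>UNIV. h (axis i (1::real)))"
proof -
  have "(Basis :: (real^'n) set) = range (\<lambda>i. axis i 1)"
    by (auto simp: Basis_vec_def)
  then have "(\<Prod>j\<in>(Basis :: (real^'n) set). h j) = prod h (range (\<lambda>i. axis i 1))"
    by (rule arg_cong)
  also have "\<dots> = (\<Prod>i\<in>UNIV. h (axis i 1))"
    by (subst prod.reindex) (auto simp: inj_on_def axis_eq_axis)
  finally show ?thesis .
qed

text \<open>A character is a product of one-variable characters, and a nonzero frequency has a
  coordinate whose factor integrates to zero.\<close>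

lemma integral_cube_cis_freq_dot:
  fixes m :: "int^'n"
  shows "(LINT x|lebesgue_on cube. cis (freq_dot m x)) = (if m = 0 then (2 * of_real pi) ^ CARD('n) else 0)"
proof -
  let ?w = "\<chi> i. real_of_int (m $ i)" and ?b = "\<chi> i::'n. 2 * pi"
  have "cis (freq_dot m x) = (\<Prod>j\<in>Basis. cis ((?w \<bullet> j) * (x \<bullet> j)))" for x
    unfolding freq_dot_inner cis_sum[symmetric] by (subst euclidean_inner) simp
  then have "(LINT x|lebesgue_on cube. cis (freq_dot m x))
      = (LINT x|lebesgue_on (cbox 0 ?b). (\<Prod>j\<in>Basis. cis ((?w \<bullet> j) * (x \<bullet> j))))"
    by (simp add: cube_def)
  also have "\<dots> = (\<Prod>j\<in>Basis. integral {0 \<bullet> j..?b \<bullet> j} (\<lambda>t. cis ((?w \<bullet> j) * t)))"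
    by (rule integral_cbox_prod)
       (auto intro!: continuous_intros simp: Basis_vec_def inner_axis)
  also have "\<dots> = (\<Prod>i\<in>UNIV. integral {0..2 * pi} (\<lambda>t. cis (of_int (m $ i) * t)))"
    by (simp add: prod_Basis_vec inner_axis)
  also have "\<dots> = (\<Prod>i\<in>UNIV. if m $ i = 0 then 2 * of_real pi else 0)"
    by (simp add: integral_cis_period)
  also have "\<dots> = (if m = 0 then (2 * of_real pi) ^ CARD('n) else 0)"
  proof (cases "m = 0")
    case False
    then obtain i where "m $ i \<noteq> 0"
      by (metis vec_eq_iff zero_index)
    then have "(\<Prod>i\<in>UNIV. if m $ i = 0 then 2 * complex_of_real pi else 0) = 0"
      by (intro prod_zero) auto
    with False show ?thesis by simp
  qed simp
  finally show ?thesis .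
qed

definition trig_poly :: "(int^'n \<Rightarrow> complex) \<Rightarrow> (int^'n) set \<Rightarrow> real^'n \<Rightarrow> complex" where
  "trig_poly c F x = (\<Sum>m\<in>F. c m * cis (freq_dot m x))"

lemma continuous_on_trig_poly: "continuous_on A (trig_poly c F)"
  unfolding trig_poly_def[abs_def] by (intro continuous_intros continuous_on_cis_freq_dot)

lemma integrable_cube_continuous:
  fixes g :: "real^'n \<Rightarrow> 'b::euclidean_space"
  shows "continuous_on UNIV g \<Longrightarrow> integrable (lebesgue_on cube) g"
  unfolding cube_def by (rule continuous_imp_integrable) (rule continuous_on_subset, auto)

lemma freq_dot_diff_left: "freq_dot (m - n) x = freq_dot m x - freq_dot n x"
  by (simp add: freq_dot_def sum_subtractf algebra_simps)

lemma freq_dot_diff_right: "freq_dot m (x - y) = freq_dot m x - freq_dot m y"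
  by (simp add: freq_dot_def sum_subtractf algebra_simps)

lemma integral_trig_poly_mult_cis:
  fixes c :: "int^'n \<Rightarrow> complex"
  assumes "finite F"
  shows "(LINT x|lebesgue_on cube. trig_poly c F x * cis (- freq_dot n x))
    = (if n \<in> F then (2 * of_real pi) ^ CARD('n) * c n else 0)"
proof -
  have "trig_poly c F x * cis (- freq_dot n x) = (\<Sum>m\<in>F. c m * cis (freq_dot (m - n) x))" for x
    by (simp add: trig_poly_def sum_distrib_right mult.assoc cis_mult freq_dot_diff_left)
  then have "(LINT x|lebesgue_on cube. trig_poly c F x * cis (- freq_dot n x))
      = (\<Sum>m\<in>F. c m * (LINT x|lebesgue_on cube. cis (freq_dot (m - n) x)))"
    by (simp add: integrable_cube_continuous continuous_on_cis_freq_dot)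
  also have "\<dots> = (\<Sum>m\<in>F. if m = n then (2 * of_real pi) ^ CARD('n) * c n else 0)"
    by (intro sum.cong refl) (simp add: integral_cube_cis_freq_dot)
  finally show ?thesis
    using assms by simp
qed

text \<open>Only the conjugate factor is expanded, which leaves coefficient integrals. The identity
  later gives monotonicity of the L2 norm in the frequency set.\<close>

lemma parseval_trig_poly:
  fixes c :: "int^'n \<Rightarrow> complex"
  assumes "finite F"
  shows "(LINT x|lebesgue_on cube. (norm (trig_poly c F x))\<^sup>2)
    = (2 * pi) ^ CARD('n) * (\<Sum>m\<in>F. (norm (c m))\<^sup>2)"
proof -
  have "complex_of_real (LINT x|lebesgue_on cube. (norm (trig_poly c F x))\<^sup>2)
      = (LINT x|lebesgue_on cube. (\<Sum>n\<in>F. cnj (c n) * (trig_poly c F x * cis (- freq_dot n x))))"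
    unfolding integral_complex_of_real[symmetric]
  proof (rule Bochner_Integration.integral_cong[OF refl])
    fix x
    have "of_real ((norm (trig_poly c F x))\<^sup>2) = trig_poly c F x * cnj (trig_poly c F x)"
      by (simp add: complex_mult_cnj cmod_power2)
    also have "cnj (trig_poly c F x) = (\<Sum>n\<in>F. cnj (c n) * cis (- freq_dot n x))"
      by (simp add: trig_poly_def cis_cnj)
    finally show "of_real ((norm (trig_poly c F x))\<^sup>2)
        = (\<Sum>n\<in>F. cnj (c n) * (trig_poly c F x * cis (- freq_dot n x)))"
      by (simp add: sum_distrib_left mult_ac)
  qed
  also have "\<dots> = (\<Sum>n\<in>F. cnj (c n) * (LINT x|lebesgue_on cube. trig_poly c F x * cis (- freq_dot n x)))"
    unfolding freq_dot_inner
    by (subst Bochner_Integration.integral_sum)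
       (auto intro!: integrable_cube_continuous continuous_intros continuous_on_trig_poly)
  also have "\<dots> = (\<Sum>n\<in>F. cnj (c n) * ((2 * of_real pi) ^ CARD('n) * c n))"
    by (intro sum.cong refl) (simp add: integral_trig_poly_mult_cis assms)
  also have "\<dots> = of_real ((2 * pi) ^ CARD('n) * (\<Sum>m\<in>F. (norm (c m))\<^sup>2))"
    by (simp add: sum_distrib_left complex_norm_square mult_ac del: of_real_power)
       (simp add: power_mult_distrib mult_ac)
  finally show ?thesis
    by (simp only: of_real_eq_iff)
qed

text \<open>Orthogonality discards the kernel frequencies outside \<open>F\<close>. Hence the kernel
  may live on a full cube \<open>G\<close>, where it factors over coordinates, although the block
  \<open>F\<close> does not.\<close>

lemma trig_poly_convolution:
  fixes c a :: "int^'n \<Rightarrow> complex"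
  assumes "finite G" "F \<subseteq> G"
  shows "(LINT y|lebesgue_on cube. trig_poly a G (x - y) * trig_poly c F y)
    = (2 * of_real pi) ^ CARD('n) * trig_poly (\<lambda>m. a m * c m) F x"
proof -
  have F: "finite F"
    using assms finite_subset by blast
  have "trig_poly a G (x - y) * trig_poly c F y
      = (\<Sum>m\<in>G. (a m * cis (freq_dot m x)) * (trig_poly c F y * cis (- freq_dot m y)))" for y
  proof -
    have "trig_poly a G (x - y) = (\<Sum>m\<in>G. a m * cis (freq_dot m x) * cis (- freq_dot m y))"
      by (simp add: trig_poly_def freq_dot_diff_right cis_mult mult.assoc)
    then show ?thesis
      by (simp only: sum_distrib_right) (simp only: mult_ac)
  qed
  then have "(LINT y|lebesgue_on cube. trig_poly a G (x - y) * trig_poly c F y)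
      = (LINT y|lebesgue_on cube.
          (\<Sum>m\<in>G. (a m * cis (freq_dot m x)) * (trig_poly c F y * cis (- freq_dot m y))))"
    by (simp only:)
  also have "\<dots> = (\<Sum>m\<in>G. (a m * cis (freq_dot m x))
      * (LINT y|lebesgue_on cube. trig_poly c F y * cis (- freq_dot m y)))"
    unfolding freq_dot_inner
    by (subst Bochner_Integration.integral_sum)
       (auto intro!: integrable_cube_continuous continuous_intros continuous_on_trig_poly)
  also have "\<dots> = (\<Sum>m\<in>G. if m \<in> F then (2 * of_real pi) ^ CARD('n) * (a m * c m * cis (freq_dot m x)) else 0)"
    by (intro sum.cong refl) (simp add: integral_trig_poly_mult_cis F)
  also have "\<dots> = (\<Sum>m\<in>F. (2 * of_real pi) ^ CARD('n) * (a m * c m * cis (freq_dot m x)))"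
    using assms by (simp add: sum.inter_restrict[symmetric] Int_absorb1)
  finally show ?thesis
    by (simp add: trig_poly_def sum_distrib_left)
qed

section \<open>Sup-norm bounds for Fourier multipliers\<close>

lemma norm_integral_mult_trig_poly_le:
  fixes k :: "real^'n \<Rightarrow> complex"
  assumes k: "continuous_on UNIV k" and B: "\<And>y. norm (k y) \<le> B"
  shows "norm (LINT y|lebesgue_on cube. k y * trig_poly c F y) \<le> B * L1_norm (trig_poly c F)"
proof -
  have "norm (LINT y|lebesgue_on cube. k y * trig_poly c F y)
      \<le> (LINT y|lebesgue_on cube. norm (k y * trig_poly c F y))"
    by (rule integral_norm_bound)
  also have "\<dots> \<le> (LINT y|lebesgue_on cube. B * norm (trig_poly c F y))"
    using k B
    by (intro integral_mono integrable_cube_continuous continuous_intros continuous_on_trig_poly)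
       (auto simp: norm_mult intro: mult_right_mono)
  finally show ?thesis
    by (simp add: L1_norm_def)
qed

lemma one_le_two_pi_power: "1 \<le> (2 * pi) ^ k"
  using pi_gt3 by (intro one_le_power) linarith

text \<open>Young's inequality between L1 and the sup norm; the normalising power of
  \<open>2 * pi\<close> is at least 1 and is dropped.\<close>

lemma norm_multiplier_le:
  fixes c a :: "int^'n \<Rightarrow> complex"
  assumes "finite G" "F \<subseteq> G" and B: "\<And>z. norm (trig_poly a G z) \<le> B"
  shows "norm (trig_poly (\<lambda>m. a m * c m) F x) \<le> B * L1_norm (trig_poly c F)"
proof -
  let ?u = "trig_poly (\<lambda>m. a m * c m) F"
  have "norm (?u x) \<le> (2 * pi) ^ CARD('n) * norm (?u x)"
    using mult_right_mono[OF one_le_two_pi_power norm_ge_zero, of "?u x" "CARD('n)"] by simp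
  also have "\<dots> = norm (LINT y|lebesgue_on cube. trig_poly a G (x - y) * trig_poly c F y)"
    unfolding trig_poly_convolution[OF assms(1,2)] by (simp add: norm_mult norm_power)
  also have "\<dots> \<le> B * L1_norm (trig_poly c F)"
    by (intro norm_integral_mult_trig_poly_le B continuous_on_compose2[OF continuous_on_trig_poly[of UNIV]]
          continuous_intros) auto
  finally show ?thesis .
qed

text \<open>Translation acts on the kernel alone, so the modulus of continuity comes from the kernel
  and \<open>c\<close> still enters only through an L1 norm.\<close>

lemma norm_multiplier_diff_le:
  fixes c a :: "int^'n \<Rightarrow> complex"
  assumes "finite G" "F \<subseteq> G"
    and B: "\<And>y. norm (trig_poly a G (x - y) - trig_poly a G (x' - y)) \<le> B"
  shows "norm (trig_poly (\<lambda>m. a m * c m) F x - trig_poly (\<lambda>m. a m * c m) F x')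
    \<le> B * L1_norm (trig_poly c F)"
proof -
  let ?u = "trig_poly (\<lambda>m. a m * c m) F"
  have cont: "continuous_on UNIV (\<lambda>y. trig_poly a G (z - y))" for z
    by (intro continuous_on_compose2[OF continuous_on_trig_poly[of UNIV]] continuous_intros) auto
  have int: "integrable (lebesgue_on cube) (\<lambda>y. trig_poly a G (z - y) * trig_poly c F y)" for z
    by (intro integrable_cube_continuous continuous_intros cont continuous_on_trig_poly)
  have "norm (?u x - ?u x') \<le> (2 * pi) ^ CARD('n) * norm (?u x - ?u x')"
    using mult_right_mono[OF one_le_two_pi_power norm_ge_zero, of "?u x - ?u x'" "CARD('n)"] by simp
  also have "\<dots> = norm ((2 * of_real pi) ^ CARD('n) * ?u x - (2 * of_real pi) ^ CARD('n) * ?u x')"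
    unfolding right_diff_distrib[symmetric] by (simp add: norm_mult norm_power)
  also have "\<dots> = norm (LINT y|lebesgue_on cube.
      (trig_poly a G (x - y) - trig_poly a G (x' - y)) * trig_poly c F y)"
    unfolding trig_poly_convolution[OF assms(1,2), symmetric] left_diff_distrib
    by (simp add: int)
  also have "\<dots> \<le> B * L1_norm (trig_poly c F)"
    by (intro norm_integral_mult_trig_poly_le B continuous_intros cont)
  finally show ?thesis .
qed

lemma freq_max_le_iff: "freq_max m \<le> K \<longleftrightarrow> (\<forall>i. \<bar>m $ i\<bar> \<le> K)"
  by (simp add: freq_max_def)

text \<open>The max-norm ball of frequencies is a product set and \<open>freq_sq\<close> is a sum
  over coordinates, so the sum factors.\<close>

lemma schrodinger_kernel_eq_prod:
  "trig_poly (\<lambda>m. cis (of_int (freq_sq m) * t)) {m :: int^'n. freq_max m \<le> int M} z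
    = (\<Prod>i\<in>UNIV. schrodinger_sum M t (z $ i))"
proof -
  let ?g = "\<lambda>i n. cis ((of_int n)\<^sup>2 * t + of_int n * z $ i)"
  have "(\<Prod>i\<in>UNIV. schrodinger_sum M t (z $ i))
      = (\<Sum>h\<in>UNIV \<rightarrow>\<^sub>E {- int M..int M}. \<Prod>i\<in>UNIV. ?g i (h i))"
    unfolding schrodinger_sum_def by (rule prod_sum_PiE) auto
  also have "\<dots> = (\<Sum>m | freq_max m \<le> int M. \<Prod>i\<in>UNIV. ?g i (m $ i))"
    by (rule sum.reindex_bij_witness[of _ vec_nth vec_lambda])
       (auto simp: freq_max_le_iff PiE_def Pi_def abs_le_iff minus_le_iff)
  also have "\<dots> = trig_poly (\<lambda>m. cis (of_int (freq_sq m) * t)) {m. freq_max m \<le> int M} z"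
    unfolding trig_poly_def
    by (intro sum.cong refl)
       (simp add: cis_sum[symmetric] cis_mult freq_sq_def freq_dot_def sum.distrib sum_distrib_right)
  finally show ?thesis by simp
qed

section \<open>Graphs of Hoelder functions\<close>

lemma covering_number_le:
  assumes "finite A" "E \<subseteq> (\<Union>a\<in>A. cbox a (a + \<epsilon> *\<^sub>R One))"
  shows "covering_number E \<epsilon> \<le> card A"
  unfolding covering_number_def using assms by (intro Least_le) blast

lemma mem_cbox_floor_grid:
  fixes x z :: "real^'n" and y w :: real
  assumes "\<And>i. z $ i \<le> x $ i \<and> x $ i \<le> z $ i + \<epsilon>" "w \<le> y" "y \<le> w + \<epsilon>"
  shows "(x, y) \<in> cbox (z, w) ((z, w) + \<epsilon> *\<^sub>R One)"
proof -
  have "((z, w) + \<epsilon> *\<^sub>R One) \<bullet> b = (z, w) \<bullet> b + \<epsilon>" if "b \<in> Basis" for b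
    using that by (simp add: inner_add_left)
  then show ?thesis
    using assms by (auto simp: mem_box Basis_prod_def Basis_vec_def inner_axis)
qed

text \<open>The cube is cut into cells of side \<open>\<epsilon>\<close>. Over one cell the graph
  stays within \<open>K * (d * \<epsilon>) powr \<gamma>\<close> of its value at the corner, so a
  short column of boxes covers it; \<open>d * \<epsilon>\<close> bounds the cell diameter through
  the l1 norm.\<close>

lemma covering_number_graph_le:
  fixes g :: "real^'n \<Rightarrow> real"
  assumes g: "\<And>x y. \<bar>g x - g y\<bar> \<le> K * dist x y powr \<gamma>" and "0 \<le> K" "0 < \<gamma>" "0 < \<epsilon>"
  shows "real (covering_number (torus_graph g) \<epsilon>)
    \<le> (2 * pi / \<epsilon> + 1) ^ CARD('n) * (2 * (K * (real CARD('n) * \<epsilon>) powr \<gamma> / \<epsilon>) + 5)"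
proof -
  let ?D = "K * (real CARD('n) * \<epsilon>) powr \<gamma> / \<epsilon>"
  define M where "M = \<lfloor>2 * pi / \<epsilon>\<rfloor>"
  \<comment> \<open>Rounding both heights down can enlarge their distance by one box, hence the
    extra 1. Since \<open>T \<le> ?D + 2\<close>, a column has
    \<open>2 * T + 1 \<le> 2 * ?D + 5\<close> boxes.\<close>
  define T where "T = \<lceil>?D\<rceil> + 1"
  define z :: "('n \<Rightarrow> int) \<Rightarrow> real^'n" where "z j = (\<chi> i. \<epsilon> * of_int (j i))" for j
  \<comment> \<open>Heights are counted from the box containing the graph point above the corner
    \<open>z j\<close>, so each column follows the graph.\<close>
  define pt where "pt = (\<lambda>(j, l). (z j, \<epsilon> * of_int (\<lfloor>g (z j) / \<epsilon>\<rfloor> + l)))"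
  let ?I = "((UNIV :: 'n set) \<rightarrow>\<^sub>E {0..M}) \<times> {- T..T}"
  have M0: "0 \<le> M" and D0: "0 \<le> ?D"
    using assms by (auto simp: M_def)
  then have T1: "1 \<le> T"
    unfolding T_def by linarith
  have fin: "finite ?I"
    by (intro finite_cartesian_product finite_PiE) auto
  have floor_le: "\<epsilon> * of_int \<lfloor>r / \<epsilon>\<rfloor> \<le> r" "r \<le> \<epsilon> * of_int \<lfloor>r / \<epsilon>\<rfloor> + \<epsilon>" for r
  proof -
    have "r = \<epsilon> * (r / \<epsilon>)"
      using \<open>0 < \<epsilon>\<close> by simp
    then show "\<epsilon> * of_int \<lfloor>r / \<epsilon>\<rfloor> \<le> r" "r \<le> \<epsilon> * of_int \<lfloor>r / \<epsilon>\<rfloor> + \<epsilon>"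
      using mult_left_mono[of "of_int \<lfloor>r / \<epsilon>\<rfloor>" "r / \<epsilon>" \<epsilon>]
        mult_left_mono[of "r / \<epsilon>" "of_int \<lfloor>r / \<epsilon>\<rfloor> + 1" \<epsilon>] \<open>0 < \<epsilon>\<close>
      by (simp_all add: distrib_left)
  qed
  have "torus_graph g \<subseteq> (\<Union>a\<in>pt ` ?I. cbox a (a + \<epsilon> *\<^sub>R One))"
  proof
    fix p assume "p \<in> torus_graph g"
    then obtain x where x: "x \<in> cube" and p: "p = (x, g x)"
      by (auto simp: torus_graph_def)
    have x_bounds: "0 \<le> x $ i" "x $ i \<le> 2 * pi" for i
      using x by (auto simp: cube_def mem_box_cart)
    define j where "j i = \<lfloor>x $ i / \<epsilon>\<rfloor>" for i
    define l where "l = \<lfloor>g x / \<epsilon>\<rfloor> - \<lfloor>g (z j) / \<epsilon>\<rfloor>"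
    have "j \<in> UNIV \<rightarrow>\<^sub>E {0..M}"
      using x_bounds \<open>0 < \<epsilon>\<close> by (auto simp: j_def M_def intro!: floor_mono divide_right_mono)
    moreover have "l \<in> {- T..T}"
    proof -
      have "dist x (z j) \<le> (\<Sum>i\<in>UNIV. \<bar>(x - z j) $ i\<bar>)"
        unfolding dist_norm by (rule norm_le_l1_cart)
      also have "\<dots> \<le> (\<Sum>i\<in>(UNIV :: 'n set). \<epsilon>)"
      proof (rule sum_mono)
        fix i
        show "\<bar>(x - z j) $ i\<bar> \<le> \<epsilon>"
          using floor_le[of "x $ i"] by (auto simp: z_def j_def)
      qed
      finally have "dist x (z j) \<le> real CARD('n) * \<epsilon>"
        by simp
      then have "\<bar>g x - g (z j)\<bar> \<le> K * (real CARD('n) * \<epsilon>) powr \<gamma>"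
        using assms by (intro order_trans[OF g] mult_left_mono powr_mono2) auto
      then have "\<bar>g x / \<epsilon> - g (z j) / \<epsilon>\<bar> \<le> ?D"
        using \<open>0 < \<epsilon>\<close> by (simp add: diff_divide_distrib[symmetric] divide_right_mono)
      then show ?thesis
        unfolding l_def T_def by (simp add: abs_le_iff) linarith
    qed
    moreover have "p \<in> cbox (pt (j, l)) (pt (j, l) + \<epsilon> *\<^sub>R One)"
      unfolding p pt_def split_conv
      by (rule mem_cbox_floor_grid) (use floor_le in \<open>auto simp: z_def j_def l_def\<close>)
    ultimately show "p \<in> (\<Union>a\<in>pt ` ?I. cbox a (a + \<epsilon> *\<^sub>R One))"
      by blast
  qed
  then have "covering_number (torus_graph g) \<epsilon> \<le> card (pt ` ?I)"
    using fin by (intro covering_number_le) auto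
  also have "\<dots> \<le> card ?I"
    using fin by (rule card_image_le)
  also have "\<dots> = nat (M + 1) ^ CARD('n) * nat (2 * T + 1)"
    using M0 by (simp add: card_cartesian_product card_PiE)
  finally have "real (covering_number (torus_graph g) \<epsilon>)
      \<le> real (nat (M + 1) ^ CARD('n) * nat (2 * T + 1))"
    by (simp only: of_nat_le_iff)
  also have "\<dots> = (of_int M + 1) ^ CARD('n) * (2 * of_int T + 1)"
    using M0 T1 by simp
  also have "\<dots> \<le> (2 * pi / \<epsilon> + 1) ^ CARD('n) * (2 * ?D + 5)"
  proof (intro mult_mono power_mono)
    show "of_int M + 1 \<le> 2 * pi / \<epsilon> + 1"
      by (simp add: M_def)
    show "2 * of_int T + 1 \<le> 2 * ?D + 5"
      using mult_left_mono[OF of_int_ceiling_le_add_one[of ?D], of 2] by (simp add: T_def)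
  qed (use M0 T1 \<open>0 < \<epsilon>\<close> in auto)
  finally show ?thesis .
qed

text \<open>After taking logarithms the constant contributes \<open>ln C / - ln \<epsilon>\<close>,
  which tends to zero.\<close>

lemma upper_minkowski_dim_le:
  fixes E :: "'a::euclidean_space set"
  assumes "1 \<le> C" "0 \<le> p"
    and N: "\<And>\<epsilon>. 0 < \<epsilon> \<Longrightarrow> \<epsilon> < 1 \<Longrightarrow> real (covering_number E \<epsilon>) \<le> C * (1 / \<epsilon>) powr p"
  shows "upper_minkowski_dim E \<le> ereal p"
proof -
  have "filterlim (\<lambda>\<epsilon>::real. - ln \<epsilon>) at_top (at_right 0)"
    using ln_at_0 by (simp add: filterlim_uminus_at_top)
  then have "((\<lambda>\<epsilon>. ln C / - ln \<epsilon>) \<longlongrightarrow> 0) (at_right 0)"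
    by (intro tendsto_divide_0[OF tendsto_const] filterlim_at_top_imp_at_infinity)
  then have "((\<lambda>\<epsilon>. ln C / - ln \<epsilon> + p) \<longlongrightarrow> 0 + p) (at_right 0)"
    by (intro tendsto_intros)
  then have lim: "((\<lambda>\<epsilon>. ereal (ln C / - ln \<epsilon> + p)) \<longlongrightarrow> ereal p) (at_right 0)"
    by simp
  have "\<forall>\<^sub>F \<epsilon> in at_right 0. ereal (ln (real (covering_number E \<epsilon>)) / ln (1 / \<epsilon>))
      \<le> ereal (ln C / - ln \<epsilon> + p)"
    unfolding eventually_at_right_field
  proof (intro exI[of _ 1] conjI allI impI)
    fix \<epsilon> :: real assume \<epsilon>: "0 < \<epsilon>" "\<epsilon> < 1"
    then have ln0: "0 < - ln \<epsilon>"
      by simp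
    have ln_inv: "ln (1 / \<epsilon>) = - ln \<epsilon>"
      using \<epsilon> by (simp add: ln_div)
    have "ln (real (covering_number E \<epsilon>)) \<le> ln C + p * - ln \<epsilon>"
    \<comment> \<open>Here \<open>ln 0\<close> takes its default value 0, and the right side is
      nonnegative because \<open>1 \<le> C\<close> and \<open>0 \<le> p\<close>.\<close>
    proof (cases "covering_number E \<epsilon> = 0")
      case True
      then show ?thesis
        using mult_nonneg_nonneg[OF assms(2) less_imp_le[OF ln0]] ln_ge_zero[OF assms(1)]
        by (simp add: add_increasing)
    next
      case False
      then have "ln (real (covering_number E \<epsilon>)) \<le> ln (C * (1 / \<epsilon>) powr p)"
        using N[OF \<epsilon>] by (subst ln_le_cancel_iff) (auto intro: order_less_le_trans[OF _ N[OF \<epsilon>]])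
      also have "\<dots> = ln C + p * ln (1 / \<epsilon>)"
        using assms(1) \<epsilon> by (subst ln_mult) (auto simp: ln_powr)
      finally show ?thesis
        by (simp only: ln_inv)
    qed
    then have "ln (real (covering_number E \<epsilon>)) / - ln \<epsilon> \<le> (ln C + p * - ln \<epsilon>) / - ln \<epsilon>"
      using ln0 by (intro divide_right_mono) auto
    also have "\<dots> = ln C / - ln \<epsilon> + p"
      using ln0 by (simp add: add_divide_distrib diff_divide_distrib)
    finally show "ereal (ln (real (covering_number E \<epsilon>)) / ln (1 / \<epsilon>)) \<le> ereal (ln C / - ln \<epsilon> + p)"
      by (simp add: ln_inv)
  qed simp
  then have "upper_minkowski_dim E \<le> Limsup (at_right 0) (\<lambda>\<epsilon>. ereal (ln C / - ln \<epsilon> + p))"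
    unfolding upper_minkowski_dim_def by (rule Limsup_mono)
  also have "\<dots> = ereal p"
    by (rule lim_imp_Limsup[OF _ lim]) simp
  finally show ?thesis .
qed

text \<open>Power counting: order \<open>\<epsilon> powr (- d)\<close> columns of order
  \<open>\<epsilon> powr (\<gamma> - 1)\<close> boxes each.\<close>

lemma upper_minkowski_dim_graph_le:
  fixes g :: "real^'n \<Rightarrow> real"
  assumes g: "\<And>x y. \<bar>g x - g y\<bar> \<le> K * dist x y powr \<gamma>" and "0 \<le> K" "0 < \<gamma>" "\<gamma> \<le> 1"
  shows "upper_minkowski_dim (torus_graph g) \<le> ereal (real (CARD('n) + 1) - \<gamma>)"
proof (rule upper_minkowski_dim_le)
  let ?d = "CARD('n)"
  let ?E = "2 * (K * real ?d powr \<gamma>) + 5"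
  have "0 \<le> K * real ?d powr \<gamma>"
    using \<open>0 \<le> K\<close> by simp
  then have E: "1 \<le> ?E" "0 \<le> ?E" by linarith+
  then show "1 \<le> 9 ^ ?d * ?E"
    using mult_mono[of 1 "9 ^ ?d" 1 ?E] by simp
  show "0 \<le> real (?d + 1) - \<gamma>"
    using assms by simp
  fix \<epsilon> :: real assume \<epsilon>: "0 < \<epsilon>" "\<epsilon> < 1"
  let ?q = "(1 / \<epsilon>) powr (1 - \<gamma>)"
  \<comment> \<open>This is where \<open>\<gamma> \<le> 1\<close> enters: the additive constant 5 in
    the column height is absorbed into a multiple of \<open>?q\<close>.\<close>
  have q: "1 \<le> ?q"
    using \<epsilon> assms by (intro ge_one_powr_ge_zero) auto
  have "(real ?d * \<epsilon>) powr \<gamma> / \<epsilon> = real ?d powr \<gamma> * ?q"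
  proof -
    have "\<epsilon> powr \<gamma> / \<epsilon> = \<epsilon> powr (\<gamma> - 1)"
      using \<epsilon> by (simp add: powr_diff)
    also have "\<dots> = ?q"
      using \<epsilon> by (simp add: powr_divide powr_minus_divide[symmetric])
    finally show ?thesis
      by (simp only: powr_mult times_divide_eq_right[symmetric])
  qed
  then have D: "K * (real ?d * \<epsilon>) powr \<gamma> / \<epsilon> = K * real ?d powr \<gamma> * ?q"
    by (metis mult.assoc times_divide_eq_right)
  have "real (covering_number (torus_graph g) \<epsilon>)
      \<le> (2 * pi / \<epsilon> + 1) ^ ?d * (2 * (K * (real ?d * \<epsilon>) powr \<gamma> / \<epsilon>) + 5)"
    using covering_number_graph_le[OF g] assms \<epsilon> by blast
  also have "\<dots> \<le> (9 * (1 / \<epsilon>)) ^ ?d * (?E * ?q)"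
  proof (intro mult_mono power_mono)
    have "2 * pi + \<epsilon> \<le> 9"
      using pi_less_4 \<epsilon> by linarith
    then show "2 * pi / \<epsilon> + 1 \<le> 9 * (1 / \<epsilon>)"
      using divide_right_mono[of "2 * pi + \<epsilon>" 9 \<epsilon>] \<epsilon> by (simp add: add_divide_distrib)
    show "2 * (K * (real ?d * \<epsilon>) powr \<gamma> / \<epsilon>) + 5 \<le> ?E * ?q"
      unfolding D using q by (simp add: distrib_right)
  qed (use \<epsilon> assms in \<open>auto intro!: add_nonneg_nonneg\<close>)
  also have "\<dots> = 9 ^ ?d * ?E * ((1 / \<epsilon>) ^ ?d * ?q)"
    by (simp only: power_mult_distrib mult_ac)
  also have "(1 / \<epsilon>) ^ ?d * ?q = (1 / \<epsilon>) powr (real (?d + 1) - \<gamma>)"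
    using \<epsilon> by (simp add: powr_realpow[symmetric] powr_add[symmetric] algebra_simps del: powr_realpow)
  finally show "real (covering_number (torus_graph g) \<epsilon>)
      \<le> 9 ^ ?d * ?E * (1 / \<epsilon>) powr (real (?d + 1) - \<gamma>)" .
qed

text \<open>The endpoint exponent \<open>s\<close> is reached by letting \<open>\<gamma>\<close>
  tend to \<open>s\<close> in the dimension bound, although Hoelder continuity is available only
  below \<open>s\<close>.\<close>

lemma graph_dim_le_of_holder:
  fixes v :: "real^'n \<Rightarrow> complex"
  assumes hol: "\<And>\<gamma>. 0 < \<gamma> \<Longrightarrow> \<gamma> < s \<Longrightarrow> holder_torus \<gamma> v" and s: "0 < s" "s \<le> 1"
  shows "graph_dim v \<le> ereal (real (CARD('n) + 1) - s)"
proof (rule ereal_le_epsilon2)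
  fix e :: real assume "0 < e"
  \<comment> \<open>The minimum with \<open>s / 2\<close> keeps the exponent positive when
    \<open>e\<close> is large.\<close>
  define \<gamma> where "\<gamma> = s - min e (s / 2)"
  have \<gamma>: "0 < \<gamma>" "\<gamma> < s" "s - e \<le> \<gamma>"
    using s \<open>0 < e\<close> by (auto simp: \<gamma>_def)
  obtain K where K: "dist (v x) (v y) \<le> K * dist x y powr \<gamma>" for x y
    using hol[OF \<gamma>(1,2)] by (auto simp: holder_torus_def)
  have K': "dist (v x) (v y) \<le> \<bar>K\<bar> * dist x y powr \<gamma>" for x y
    by (rule order_trans[OF K]) (intro mult_right_mono, auto)
  have "\<bar>Re (v x) - Re (v y)\<bar> \<le> \<bar>K\<bar> * dist x y powr \<gamma>"
    "\<bar>Im (v x) - Im (v y)\<bar> \<le> \<bar>K\<bar> * dist x y powr \<gamma>" for x y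
    using K'[of x y] abs_Re_le_cmod[of "v x - v y"] abs_Im_le_cmod[of "v x - v y"]
    by (auto simp: dist_norm)
  then have "graph_dim v \<le> ereal (real (CARD('n) + 1) - \<gamma>)"
    unfolding graph_dim_def using \<gamma> s
    by (intro max.boundedI upper_minkowski_dim_graph_le) auto
  also have "\<dots> \<le> ereal (real (CARD('n) + 1) - s) + ereal e"
    using \<gamma> by simp
  finally show "graph_dim v \<le> ereal (real (CARD('n) + 1) - s) + ereal e" .
qed

section \<open>The evolved series\<close>

text \<open>Dividing every factor by \<open>W\<close> moves it into the unit disc, where a
  difference of products is at most the sum of the differences of the factors. That sum over
  coordinates yields the factor \<open>CARD('n)\<close>.\<close>

lemma schrodinger_kernel_bounds:
  fixes z z' :: "real^'n" and t :: real
  assumes "2 * M < H"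
  defines "W \<equiv> sqrt (weyl_majorant H t)"
  shows "norm (\<Prod>i\<in>UNIV. schrodinger_sum M t (z $ i)) \<le> W ^ CARD('n)"
    and "norm ((\<Prod>i\<in>UNIV. schrodinger_sum M t (z $ i)) - (\<Prod>i\<in>UNIV. schrodinger_sum M t (z' $ i)))
      \<le> W ^ CARD('n) * (3 * real CARD('n) * real M * dist z z')"
proof -
  have W: "0 < W"
    unfolding W_def using weyl_majorant_pos[of H t] assms by simp
  have le: "norm (schrodinger_sum M t x) \<le> W" for x
    unfolding W_def by (rule norm_schrodinger_sum_le[OF assms(1)])
  have "(\<Prod>i\<in>UNIV. norm (schrodinger_sum M t (z $ i))) \<le> (\<Prod>i\<in>(UNIV :: 'n set). W)"
    by (intro prod_mono) (auto simp: le)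
  then show "norm (\<Prod>i\<in>UNIV. schrodinger_sum M t (z $ i)) \<le> W ^ CARD('n)"
    by (simp add: prod_norm)
  let ?s = "\<lambda>x. schrodinger_sum M t x / of_real W"
  have scale: "(\<Prod>i\<in>UNIV. schrodinger_sum M t (y $ i)) = of_real W ^ CARD('n) * (\<Prod>i\<in>UNIV. ?s (y $ i))"
    for y :: "real^'n"
    using W by (simp add: prod_dividef)
  have "norm ((\<Prod>i\<in>UNIV. ?s (z $ i)) - (\<Prod>i\<in>UNIV. ?s (z' $ i)))
      \<le> (\<Sum>i\<in>UNIV. norm (?s (z $ i) - ?s (z' $ i)))"
    using W le by (intro norm_prod_diff) (auto simp: norm_divide divide_le_eq)
  also have "\<dots> \<le> (\<Sum>i\<in>(UNIV :: 'n set). 3 * real M * dist z z')"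
  proof (rule sum_mono)
    fix i
    have "norm (?s (z $ i) - ?s (z' $ i))
        = norm (schrodinger_sum M t (z $ i) - schrodinger_sum M t (z' $ i)) / W"
      using W by (simp add: norm_divide diff_divide_distrib[symmetric])
    also have "\<dots> \<le> W * (3 * real M * \<bar>z $ i - z' $ i\<bar>) / W"
      using W norm_schrodinger_sum_diff_le[OF assms(1), of t "z $ i" "z' $ i"]
      by (intro divide_right_mono) (auto simp: W_def)
    also have "\<dots> = 3 * real M * dist (z $ i) (z' $ i)"
      using W by (simp add: dist_real_def)
    also have "\<dots> \<le> 3 * real M * dist z z'"
      by (intro mult_left_mono dist_vec_nth_le) auto
    finally show "norm (?s (z $ i) - ?s (z' $ i)) \<le> 3 * real M * dist z z'" .
  qed
  finally have "W ^ CARD('n) * norm ((\<Prod>i\<in>UNIV. ?s (z $ i)) - (\<Prod>i\<in>UNIV. ?s (z' $ i)))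
      \<le> W ^ CARD('n) * (3 * real CARD('n) * real M * dist z z')"
    using W by (intro mult_left_mono) (auto simp: mult_ac)
  moreover have "norm (of_real W ^ CARD('n) * a - of_real W ^ CARD('n) * b) = W ^ CARD('n) * norm (a - b)"
    for a b :: complex
    using W unfolding right_diff_distrib[symmetric] by (simp add: norm_mult norm_power)
  ultimately show "norm ((\<Prod>i\<in>UNIV. schrodinger_sum M t (z $ i)) - (\<Prod>i\<in>UNIV. schrodinger_sum M t (z' $ i)))
      \<le> W ^ CARD('n) * (3 * real CARD('n) * real M * dist z z')"
    unfolding scale by simp
qed

section \<open>Dyadic blocks of the evolved series\<close>

definition dyadic_block :: "nat \<Rightarrow> (int^'n) set" where
  "dyadic_block k = {m. int (2 ^ k) < freq_max m \<and> freq_max m \<le> 2 * int (2 ^ k)}"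

definition evolved_coeff :: "(real^'n \<Rightarrow> real) \<Rightarrow> real \<Rightarrow> int^'n \<Rightarrow> complex" where
  "evolved_coeff f t m = cis (of_int (freq_sq m) * t) * fourier_coeff f m"

text \<open>The evolution is a Fourier multiplier acting on \<open>freq_block f (2 ^ k)\<close>. Its
  kernel is taken on all frequencies up to \<open>M = 2 * 2 ^ k\<close>, so
  \<open>2 * M < 5 * 2 ^ k\<close>, and \<open>3 * M\<close> becomes the \<open>6 * 2 ^ k\<close> of
  the second bound.\<close>

lemma evolved_block_bounds:
  fixes f :: "real^'n \<Rightarrow> real" and k :: nat and t :: real
  defines "W \<equiv> sqrt (weyl_majorant (5 * 2 ^ k) t)"
  defines "u \<equiv> trig_poly (evolved_coeff f t) (dyadic_block k)"
  shows "norm (u x) \<le> W ^ CARD('n) * L1_norm (freq_block f (2 ^ k))"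
    and "norm (u x - u x') \<le> W ^ CARD('n) * (6 * real CARD('n) * 2 ^ k * dist x x')
      * L1_norm (freq_block f (2 ^ k))"
proof -
  let ?a = "\<lambda>m. cis (of_int (freq_sq m) * t)" and ?G = "{m :: int^'n. freq_max m \<le> int (2 * 2 ^ k)}"
  have u: "u = trig_poly (\<lambda>m. ?a m * fourier_coeff f m) (dyadic_block k)"
    by (simp add: u_def evolved_coeff_def[abs_def])
  have fb: "freq_block f (2 ^ k) = trig_poly (fourier_coeff f) (dyadic_block k)"
    by (simp add: freq_block_def trig_poly_def dyadic_block_def fun_eq_iff)
  have G: "finite ?G" "dyadic_block k \<subseteq> ?G"
    by (auto intro: finite_freq_max simp: dyadic_block_def)
  have MH: "2 * (2 * 2 ^ k) < (5 * 2 ^ k :: nat)"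
    by simp
  note kernel = schrodinger_kernel_eq_prod[where 'n = 'n and M = "2 * 2 ^ k" and t = t]
  show "norm (u x) \<le> W ^ CARD('n) * L1_norm (freq_block f (2 ^ k))"
    unfolding u fb W_def
    by (intro norm_multiplier_le[OF G]) (unfold kernel, rule schrodinger_kernel_bounds(1)[OF MH])
  have "norm (trig_poly ?a ?G (x - y) - trig_poly ?a ?G (x' - y))
      \<le> W ^ CARD('n) * (6 * real CARD('n) * 2 ^ k * dist x x')" for y
    using schrodinger_kernel_bounds(2)[OF MH, of t "x - y" "x' - y"]
    unfolding kernel W_def by (simp add: mult_ac dist_norm)
  then show "norm (u x - u x') \<le> W ^ CARD('n) * (6 * real CARD('n) * 2 ^ k * dist x x')
      * L1_norm (freq_block f (2 ^ k))"
    unfolding u fb by (rule norm_multiplier_diff_le[OF G])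
qed

text \<open>The \<open>d\<close>-th power of the square root of the Weyl bound grows like
  \<open>(2 ^ k) powr (d / 2 + \<eta>)\<close>, and the L1 hypothesis cancels the
  \<open>d / 2\<close>. The exponent \<open>2 * \<eta> / d\<close> is chosen to become
  \<open>\<eta>\<close> in this power.\<close>

lemma evolved_block_decay:
  fixes f :: "real^'n \<Rightarrow> real"
  assumes L1: "\<And>k::nat. L1_norm (freq_block f (2 ^ k)) \<le>
            C * real (2 ^ k) powr (- (real CARD('n) / 2 + s))"
    and weyl: "\<And>k. weyl_majorant (5 * 2 ^ k) t \<le> B * (2 ^ k) powr (1 + 2 * \<eta> / real CARD('n))"
  shows "\<exists>A\<ge>0. \<forall>k x x'.
    norm (trig_poly (evolved_coeff f t) (dyadic_block k) x) \<le> A * (2 ^ k) powr (\<eta> - s) \<and>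
    norm (trig_poly (evolved_coeff f t) (dyadic_block k) x - trig_poly (evolved_coeff f t) (dyadic_block k) x')
      \<le> A * (2 ^ k) powr (\<eta> - s) * (2 ^ k * dist x x')"
proof -
  let ?d = "CARD('n)"
  let ?u = "\<lambda>k. trig_poly (evolved_coeff f t) (dyadic_block k :: (int^'n) set)"
  define W where "W k = sqrt (weyl_majorant (5 * 2 ^ k) t)" for k
  define L where "L k = L1_norm (freq_block f (2 ^ k))" for k
  define A0 where "A0 = sqrt B ^ ?d * C"
  \<comment> \<open>The signs of \<open>B\<close> and \<open>C\<close> are read off at
    \<open>k = 0\<close>, where the powers equal 1.\<close>
  have B: "0 \<le> B"
    using weyl[of 0] weyl_majorant_pos[of 5 t] by simp
  have L0: "0 \<le> L k" for k
    unfolding L_def L1_norm_def by (intro Bochner_Integration.integral_nonneg) auto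
  have C: "0 \<le> C"
    using L1[of 0] L0[of 0] by (simp add: L_def)
  have A0: "0 \<le> A0"
    using B C by (simp add: A0_def)
  have WL: "W k ^ ?d * L k \<le> A0 * (2 ^ k) powr (\<eta> - s)" for k
  proof -
    have "W k \<le> sqrt (B * (2 ^ k) powr (1 + 2 * \<eta> / real ?d))"
      unfolding W_def by (intro real_sqrt_le_mono weyl)
    also have "\<dots> = sqrt B * (2 ^ k) powr ((1 + 2 * \<eta> / real ?d) / 2)"
      by (simp add: real_sqrt_mult powr_half_sqrt[symmetric] powr_powr)
    finally have W: "W k \<le> sqrt B * (2 ^ k) powr ((1 + 2 * \<eta> / real ?d) / 2)" .
    have "0 \<le> W k"
      by (simp add: W_def weyl_majorant_nonneg)
    then have "W k ^ ?d \<le> (sqrt B * (2 ^ k) powr ((1 + 2 * \<eta> / real ?d) / 2)) ^ ?d"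
      by (intro power_mono W)
    also have "\<dots> = sqrt B ^ ?d * (2 ^ k) powr (real ?d / 2 + \<eta>)"
      by (simp add: power_mult_distrib powr_power add_divide_distrib distrib_left)
    finally have "W k ^ ?d * L k \<le> sqrt B ^ ?d * (2 ^ k) powr (real ?d / 2 + \<eta>)
        * (C * (2 ^ k) powr (- (real ?d / 2 + s)))"
      using L1[of k] L0[of k] B by (intro mult_mono) (auto simp: L_def)
    also have "\<dots> = A0 * ((2 ^ k) powr (real ?d / 2 + \<eta>) * (2 ^ k) powr (- (real ?d / 2 + s)))"
      by (simp only: A0_def mult_ac)
    also have "\<dots> = A0 * (2 ^ k) powr (\<eta> - s)"
      by (simp only: powr_add[symmetric]) simp
    finally show ?thesis .
  qed
  define A where "A = 6 * real ?d * A0"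
  have "1 \<le> real ?d"
    by (simp add: Suc_le_eq)
  then have d6: "1 \<le> 6 * real ?d"
    by linarith
  have "A0 \<le> A"
    using mult_right_mono[OF d6 A0] by (simp add: A_def)
  have b1: "norm (?u k x) \<le> A * (2 ^ k) powr (\<eta> - s)" for k x
  proof -
    have "norm (?u k x) \<le> W k ^ ?d * L k"
      unfolding W_def L_def by (rule evolved_block_bounds(1))
    also note WL
    also have "A0 * (2 ^ k) powr (\<eta> - s) \<le> A * (2 ^ k) powr (\<eta> - s)"
      using \<open>A0 \<le> A\<close> by (intro mult_right_mono) auto
    finally show ?thesis .
  qed
  have b2: "norm (?u k x - ?u k x') \<le> A * (2 ^ k) powr (\<eta> - s) * (2 ^ k * dist x x')" for k x x'
  proof -
    have "norm (?u k x - ?u k x') \<le> W k ^ ?d * (6 * real ?d * 2 ^ k * dist x x') * L k"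
      unfolding W_def L_def by (rule evolved_block_bounds(2))
    also have "\<dots> = (W k ^ ?d * L k) * (6 * real ?d * 2 ^ k * dist x x')"
      by (simp only: mult_ac)
    also have "\<dots> \<le> (A0 * (2 ^ k) powr (\<eta> - s)) * (6 * real ?d * 2 ^ k * dist x x')"
      by (intro mult_right_mono WL) auto
    finally show ?thesis
      by (simp only: A_def mult_ac)
  qed
  show ?thesis
    using b1 b2 A0 \<open>A0 \<le> A\<close> by (intro exI[of _ A]) auto
qed

text \<open>Interpolates between a sup bound and a Lipschitz bound, because the minimum of 1 and
  \<open>q\<close> is at most \<open>q powr \<gamma>\<close>.\<close>

lemma powr_interpolate:
  fixes a :: real
  assumes "d \<le> 2 * a" "d \<le> a * q" "0 \<le> a" "0 \<le> q" "0 < \<gamma>" "\<gamma> \<le> 1"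
  shows "d \<le> 2 * a * q powr \<gamma>"
proof (cases "q \<le> 1")
  case True
  have "q powr 1 \<le> q powr \<gamma>"
    using True assms by (intro powr_mono') auto
  then have "a * q \<le> a * q powr \<gamma>"
    using assms by (intro mult_left_mono) auto
  moreover have "0 \<le> a * q powr \<gamma>"
    using assms by simp
  ultimately show ?thesis
    using assms(2) by linarith
next
  case False
  then have "1 \<le> q powr \<gamma>"
    using assms by (intro ge_one_powr_ge_zero) auto
  then have "2 * a * 1 \<le> 2 * a * q powr \<gamma>"
    using assms by (intro mult_left_mono) auto
  then show ?thesis
    using assms(1) by linarith
qed

text \<open>Serves the frequencies with \<open>freq_max m \<le> 1\<close>, which lie in no dyadic
  block. The weights \<open>a m\<close> bound both the size and the Lipschitz constant of a
  term.\<close>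

lemma holder_trig_poly:
  fixes c :: "int^'n \<Rightarrow> complex"
  assumes "0 < \<gamma>" "\<gamma> \<le> 1"
  shows "\<exists>K\<ge>0. \<forall>x y. norm (trig_poly c F x - trig_poly c F y) \<le> K * dist x y powr \<gamma>"
proof -
  define w :: "int^'n \<Rightarrow> real^'n" where "w m = (\<chi> i. real_of_int (m $ i))" for m
  define a where "a m = norm (c m) * (1 + norm (w m))" for m
  have "norm (trig_poly c F x - trig_poly c F y) \<le> 2 * (\<Sum>m\<in>F. a m) * dist x y powr \<gamma>" for x y
  proof (rule powr_interpolate)
    have diff: "trig_poly c F x - trig_poly c F y = (\<Sum>m\<in>F. c m * (cis (freq_dot m x) - cis (freq_dot m y)))"
      by (simp add: trig_poly_def sum_subtractf right_diff_distrib)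
    have cm: "norm (c m) \<le> a m" "norm (c m) * norm (w m) \<le> a m" for m
      by (simp_all add: a_def distrib_left)
    have "norm (c m * (cis (freq_dot m x) - cis (freq_dot m y))) \<le> 2 * a m" for m
    proof -
      have "norm (c m * (cis (freq_dot m x) - cis (freq_dot m y))) \<le> norm (c m) * 2"
        using norm_triangle_ineq4[of "cis (freq_dot m x)" "cis (freq_dot m y)"]
        unfolding norm_mult by (intro mult_left_mono) auto
      then show ?thesis
        using cm(1)[of m] by linarith
    qed
    then show "norm (trig_poly c F x - trig_poly c F y) \<le> 2 * (\<Sum>m\<in>F. a m)"
      unfolding diff sum_distrib_left by (intro sum_norm_le)
    have "norm (c m * (cis (freq_dot m x) - cis (freq_dot m y))) \<le> a m * dist x y" for m
    proof -
      have "norm (cis (freq_dot m x) - cis (freq_dot m y)) \<le> \<bar>w m \<bullet> (x - y)\<bar>"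
        using norm_cis_diff_le[of "freq_dot m x" "freq_dot m y"]
        by (simp add: freq_dot_inner w_def inner_diff_right)
      also have "\<dots> \<le> norm (w m) * dist x y"
        unfolding dist_norm by (rule Cauchy_Schwarz_ineq2)
      finally have "norm (c m * (cis (freq_dot m x) - cis (freq_dot m y)))
          \<le> norm (c m) * (norm (w m) * dist x y)"
        unfolding norm_mult by (intro mult_left_mono) auto
      also have "\<dots> \<le> a m * dist x y"
        unfolding mult.assoc[symmetric] by (intro mult_right_mono cm) auto
      finally show ?thesis .
    qed
    then show "norm (trig_poly c F x - trig_poly c F y) \<le> (\<Sum>m\<in>F. a m) * dist x y"
      unfolding diff sum_distrib_right by (intro sum_norm_le)
  qed (use assms in \<open>auto simp: a_def intro!: sum_nonneg\<close>)
  moreover have "0 \<le> 2 * (\<Sum>m\<in>F. a m)"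
    by (auto simp: a_def intro!: sum_nonneg mult_nonneg_nonneg)
  ultimately show ?thesis by blast
qed

section \<open>Periodicity and L2 summation of the series\<close>

lemma periodic_trig_poly:
  fixes c :: "int^'n \<Rightarrow> complex"
  shows "periodic (trig_poly c F)"
proof -
  have "cis (freq_dot m (x + axis i (2 * pi))) = cis (freq_dot m x)" for m :: "int^'n" and x i
  proof -
    have "freq_dot m (x + axis i (2 * pi)) = freq_dot m x + 2 * pi * of_int (m $ i)"
      by (simp add: freq_dot_inner inner_add_right inner_axis)
    then show ?thesis
      by (simp add: cis_mult[symmetric] cis_multiple_2pi)
  qed
  then show ?thesis
    by (simp add: periodic_def trig_poly_def)
qed

lemma trig_poly_diff_subset:
  assumes "finite G" "F \<subseteq> G"
  shows "trig_poly c G x - trig_poly c F x = trig_poly c (G - F) x"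
  using sum.subset_diff[OF assms(2,1), of "\<lambda>m. c m * cis (freq_dot m x)"]
  by (simp add: trig_poly_def)

text \<open>
  By orthogonality the distance of two partial sums is monotone in the set of frequencies between
  them, so convergence along one exhausting sequence of frequency sets already implies
  unconditional convergence.
\<close>

lemma L2_unconditional_of_uniform_limit:
  fixes c :: "int^'n \<Rightarrow> complex"
  assumes Q: "\<And>k. finite (Q k)" "mono Q" "(\<Union>k. Q k) = UNIV"
    and lim: "uniform_limit UNIV (\<lambda>k. trig_poly c (Q k)) v sequentially"
  shows "((\<lambda>F. LINT x|lebesgue_on cube. (norm (v x - trig_poly c F x))\<^sup>2) \<longlongrightarrow> 0)
    (finite_subsets_at_top UNIV)"
proof (rule tendstoI)
  fix e :: real assume "0 < e"
  let ?I = "\<lambda>g :: real^'n \<Rightarrow> real. LINT x|lebesgue_on cube. g x"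
  define V where "V = ?I (\<lambda>x. 1)"
  have V: "0 \<le> V"
    unfolding V_def by (intro Bochner_Integration.integral_nonneg) auto
  \<comment> \<open>The errors below add up to
    \<open>2 * d^2 * V + 2 * (2 * d)^2 * V = 10 * d^2 * V\<close>, which this choice keeps below
    \<open>e\<close>.\<close>
  define d where "d = sqrt (e / (10 * (V + 1)))"
  have d: "0 < d" "d\<^sup>2 = e / (10 * (V + 1))"
    using \<open>0 < e\<close> V by (auto simp: d_def)
  have cont_v: "continuous_on UNIV v"
    by (rule uniform_limit_theorem[OF _ lim]) (simp_all add: continuous_on_trig_poly)
  from uniform_limitD[OF lim d(1)] obtain k where
    k: "\<And>j x. k \<le> j \<Longrightarrow> dist (trig_poly c (Q j) x) (v x) < d"
    unfolding eventually_sequentially by blast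
  have close: "?I (\<lambda>x. (norm (v x - trig_poly c F x))\<^sup>2) < e" if F: "finite F" "Q k \<subseteq> F" for F
  proof -
    have "\<exists>j. F \<subseteq> Q j"
      using F(1)
    proof (induction rule: finite_induct)
      case (insert m F)
      then obtain i j where "F \<subseteq> Q i" "m \<in> Q j"
        using Q(3) by blast
      then have "insert m F \<subseteq> Q (max i j)"
        using monoD[OF Q(2), of i "max i j"] monoD[OF Q(2), of j "max i j"] by auto
      then show ?case by blast
    qed auto
    then obtain j where j: "F \<subseteq> Q j" by blast
    let ?P = "\<lambda>i. trig_poly c (Q i)"
    have sq: "(norm (v x - trig_poly c F x))\<^sup>2
        \<le> 2 * d\<^sup>2 + 2 * (norm (trig_poly c (Q (max j k) - F) x))\<^sup>2" for x
    proof -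
      have "F \<subseteq> Q (max j k)"
        using j monoD[OF Q(2), of j "max j k"] by auto
      then have "v x - trig_poly c F x = (v x - ?P (max j k) x) + trig_poly c (Q (max j k) - F) x"
        using trig_poly_diff_subset[OF Q(1), of F "max j k" c x, symmetric] by simp
      then have "norm (v x - trig_poly c F x)
          \<le> norm (v x - ?P (max j k) x) + norm (trig_poly c (Q (max j k) - F) x)"
        by (metis norm_triangle_ineq)
      also have "\<dots> \<le> d + norm (trig_poly c (Q (max j k) - F) x)"
        using k[of "max j k" x] by (simp add: dist_norm norm_minus_commute)
      finally have "(norm (v x - trig_poly c F x))\<^sup>2 \<le> (d + norm (trig_poly c (Q (max j k) - F) x))\<^sup>2"
        by (intro power_mono) auto
      also have "\<dots> \<le> 2 * d\<^sup>2 + 2 * (norm (trig_poly c (Q (max j k) - F) x))\<^sup>2"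
        using sum_squares_ge_zero sum_squares_bound[of d "norm (trig_poly c (Q (max j k) - F) x)"]
        by (simp add: power2_sum)
      finally show ?thesis .
    qed
    \<comment> \<open>The set \<open>F\<close> may be arbitrary above \<open>Q k\<close>, so no
      uniform bound is at hand for its tail. Parseval compares it with the tail beyond
      \<open>Q k\<close>, a difference of two members of the uniformly convergent sequence.\<close>
    have "?I (\<lambda>x. (norm (trig_poly c (Q (max j k) - F) x))\<^sup>2)
        \<le> ?I (\<lambda>x. (norm (trig_poly c (Q (max j k) - Q k) x))\<^sup>2)"
      using Q(1) F(2) by (simp add: parseval_trig_poly) (intro sum_mono2, auto)
    also have "\<dots> \<le> ?I (\<lambda>x. (2 * d)\<^sup>2 * 1)"
    proof (intro integral_mono integrable_cube_continuous continuous_intros continuous_on_trig_poly)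
      fix x
      have "norm (trig_poly c (Q (max j k) - Q k) x) = norm (?P (max j k) x - ?P k x)"
        using trig_poly_diff_subset[OF Q(1), of "Q k" "max j k" c x] monoD[OF Q(2), of k "max j k"]
        by simp
      also have "\<dots> \<le> 2 * d"
        using k[of "max j k" x] k[of k x] dist_triangle2[of "?P (max j k) x" "?P k x" "v x"]
        by (simp add: dist_norm)
      finally show "(norm (trig_poly c (Q (max j k) - Q k) x))\<^sup>2 \<le> (2 * d)\<^sup>2 * 1"
        using power_mono[OF _ norm_ge_zero, of _ "2 * d" 2] by simp
    qed
    also have "\<dots> = (2 * d)\<^sup>2 * V"
      unfolding V_def by (rule integral_mult_right_zero)
    finally have tail: "?I (\<lambda>x. (norm (trig_poly c (Q (max j k) - F) x))\<^sup>2) \<le> (2 * d)\<^sup>2 * V" .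
    have "?I (\<lambda>x. (norm (v x - trig_poly c F x))\<^sup>2)
        \<le> ?I (\<lambda>x. 2 * d\<^sup>2 * 1 + 2 * (norm (trig_poly c (Q (max j k) - F) x))\<^sup>2)"
      using sq
      by (intro integral_mono integrable_cube_continuous continuous_intros cont_v
            continuous_on_trig_poly) simp
    also have "\<dots> = 2 * d\<^sup>2 * V + 2 * ?I (\<lambda>x. (norm (trig_poly c (Q (max j k) - F) x))\<^sup>2)"
      unfolding V_def
      by (subst Bochner_Integration.integral_add)
         (auto intro!: integrable_cube_continuous continuous_intros continuous_on_trig_poly)
    also have "\<dots> \<le> 2 * d\<^sup>2 * V + 2 * ((2 * d)\<^sup>2 * V)"
      by (intro add_left_mono mult_left_mono[OF tail]) simp
    also have "\<dots> = 10 * d\<^sup>2 * V"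
      by (simp add: power_mult_distrib)
    also have "\<dots> = e * (V / (V + 1))"
      using V by (simp add: d(2) field_simps)
    also have "\<dots> < e * 1"
      using V \<open>0 < e\<close> by (intro mult_strict_left_mono) auto
    finally show ?thesis by simp
  qed
  have "0 \<le> ?I (\<lambda>x. (norm (v x - trig_poly c F x))\<^sup>2)" for F
    by (intro Bochner_Integration.integral_nonneg) auto
  then show "\<forall>\<^sub>F F in finite_subsets_at_top UNIV.
      dist (LINT x|lebesgue_on cube. (norm (v x - trig_poly c F x))\<^sup>2) 0 < e"
    unfolding eventually_finite_subsets_at_top using close Q(1)
    by (intro exI[of _ "Q k"]) (auto simp: dist_real_def)
qed

text \<open>The blocks are open below and closed above, so they tile the frequencies without overlap
  once those with \<open>freq_max m \<le> 1\<close> are set aside.\<close>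

lemma trig_poly_dyadic_sum:
  "trig_poly c {m :: int^'n. freq_max m \<le> int (2 ^ n)} x
    = trig_poly c {m. freq_max m \<le> 1} x + (\<Sum>k<n. trig_poly c (dyadic_block k) x)"
proof (induction n)
  case (Suc n)
  have "{m :: int^'n. freq_max m \<le> int (2 ^ Suc n)} = {m. freq_max m \<le> int (2 ^ n)} \<union> dyadic_block n"
    using order_trans[of "freq_max m" "int (2 ^ n)" "int (2 ^ Suc n)" for m :: "int^'n"]
    by (fastforce simp: dyadic_block_def)
  moreover have "{m :: int^'n. freq_max m \<le> int (2 ^ n)} \<inter> dyadic_block n = {}"
    by (auto simp: dyadic_block_def)
  moreover have "finite (dyadic_block n :: (int^'n) set)"
    by (rule finite_subset[OF _ finite_freq_max[of "2 * int (2 ^ n)"]]) (auto simp: dyadic_block_def)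
  ultimately have "trig_poly c {m :: int^'n. freq_max m \<le> int (2 ^ Suc n)} x
      = trig_poly c {m. freq_max m \<le> int (2 ^ n)} x + trig_poly c (dyadic_block n) x"
    unfolding trig_poly_def by (simp only: sum.union_disjoint finite_freq_max)
  then show ?case
    using Suc by simp
qed simp

theorem theorem6p1:
  fixes f :: "real^'n \<Rightarrow> real" and s C :: real
  assumes "L2_torus f"
    and "0 < s" and "s \<le> 1"
    and "\<And>k::nat. L1_norm (freq_block f (2 ^ k)) \<le>
            C * real (2 ^ k) powr (- (real CARD('n) / 2 + s))"
  shows "AE t in lborel. \<exists>v. evolution f t v \<and>
            (\<forall>\<gamma>. 0 < \<gamma> \<and> \<gamma> < s \<longrightarrow> holder_torus \<gamma> v) \<and>
            graph_dim v \<le> ereal (real (CARD('n) + 1) - s)"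
proof -
  \<comment> \<open>Restricting the loss \<open>\<eta>\<close> to the values
    \<open>1 / (j + 1)\<close> gives one null set of times that serves every Hoelder exponent at
    once.\<close>
  have "AE t in lborel. \<forall>j. \<exists>B. \<forall>k. weyl_majorant (5 * 2 ^ k) t
      \<le> B * (2 ^ k) powr (1 + 2 * inverse (real (Suc j)) / real CARD('n))"
    unfolding AE_all_countable by (auto intro!: AE_weyl_majorant_dyadic_bound)
  then show ?thesis
  proof eventually_elim
    case (elim t)
    define c where "c = evolved_coeff f t"
    define u where "u k = trig_poly c (dyadic_block k)" for k
    have decay: "\<exists>\<eta> A. \<eta> < \<epsilon> \<and> 0 \<le> A \<and> (\<forall>k x y. norm (u k x) \<le> A * (2 ^ k) powr (\<eta> - s)
        \<and> norm (u k x - u k y) \<le> A * (2 ^ k) powr (\<eta> - s) * (2 ^ k * dist x y))"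
      if pos: "0 < \<epsilon>" for \<epsilon>
    proof -
      obtain j where j: "inverse (real (Suc j)) < \<epsilon>"
        using reals_Archimedean[OF pos] by blast
      obtain B where "\<And>k. weyl_majorant (5 * 2 ^ k) t
          \<le> B * (2 ^ k) powr (1 + 2 * inverse (real (Suc j)) / real CARD('n))"
        using elim by blast
      from evolved_block_decay[OF assms(4) this] j show ?thesis
        unfolding u_def c_def by blast
    qed
    \<comment> \<open>The continuous representative: grouped dyadically the series converges
      uniformly, and this \<open>v\<close> is fixed before any \<open>\<gamma>\<close>.\<close>
    define v where "v x = trig_poly c {m. freq_max m \<le> 1} x + (\<Sum>k. u k x)" for x
    have geometric: "summable (\<lambda>k. K * (2 ^ k) powr (- \<epsilon>))" if "0 < \<epsilon>" for K \<epsilon> :: real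
      using that unfolding power_powr_commute
      by (intro summable_mult summable_geometric) (auto simp: powr_less_one)
    obtain \<eta>0 A0 where A0: "\<eta>0 < s" "\<And>k x. norm (u k x) \<le> A0 * (2 ^ k) powr (- (s - \<eta>0))"
      using decay[OF assms(2)] by auto
    have summable_bound: "summable (\<lambda>k. A0 * (2 ^ k) powr (- (s - \<eta>0)))"
      using A0(1) by (intro geometric) simp
    have sum_u: "summable (\<lambda>k. u k x)" for x
      by (rule summable_comparison_test'[OF summable_bound]) (rule A0(2))
    have lim: "uniform_limit UNIV (\<lambda>n. trig_poly c {m. freq_max m \<le> int (2 ^ n)}) v sequentially"
    proof -
      have "uniform_limit UNIV (\<lambda>n x. \<Sum>k<n. u k x) (\<lambda>x. \<Sum>k. u k x) sequentially"
        by (rule Weierstrass_m_test[OF A0(2) summable_bound])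
      from uniform_limit_add[OF uniform_limit_const this, of "trig_poly c {m. freq_max m \<le> 1}"]
      show ?thesis
        unfolding trig_poly_dyadic_sum u_def[symmetric] v_def[abs_def]
        by (simp add: trig_poly_dyadic_sum u_def[symmetric] cong: uniform_limit_cong)
    qed
    have cont: "continuous_on UNIV v"
      by (rule uniform_limit_theorem[OF _ lim]) (simp_all add: continuous_on_trig_poly)
    have per: "periodic v"
      using periodic_trig_poly[of c] unfolding v_def[abs_def] u_def periodic_def by simp
    have holder: "holder_torus \<gamma> v" if \<gamma>: "0 < \<gamma>" "\<gamma> < s" for \<gamma>
    proof -
      obtain \<eta> A where "\<eta> < s - \<gamma>" "0 \<le> A"
        and A: "\<And>k x. norm (u k x) \<le> A * (2 ^ k) powr (\<eta> - s)"
          "\<And>k x y. norm (u k x - u k y) \<le> A * (2 ^ k) powr (\<eta> - s) * (2 ^ k * dist x y)"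
        using decay[of "s - \<gamma>"] \<gamma> by auto
      obtain K0 where K0: "0 \<le> K0" "\<And>x y. norm (trig_poly c {m. freq_max m \<le> 1} x
          - trig_poly c {m. freq_max m \<le> 1} y) \<le> K0 * dist x y powr \<gamma>"
        using holder_trig_poly[of \<gamma> c] \<gamma> assms(3) by (meson less_imp_le order_trans)
      \<comment> \<open>The Hoelder constant of the \<open>k\<close>-th block: interpolation costs
        \<open>(2 ^ k) powr \<gamma>\<close> on top of the decay
        \<open>(2 ^ k) powr (\<eta> - s)\<close>. It is summable because
        \<open>\<eta> < s - \<gamma>\<close>.\<close>
      define b where "b k = 2 * A * (2 ^ k) powr (- (s - \<gamma> - \<eta>))" for k
      have b_sum: "summable b"
        unfolding b_def using \<open>\<eta> < s - \<gamma>\<close> by (intro geometric) simp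
      have diff_le: "norm (u k x - u k y) \<le> b k * dist x y powr \<gamma>" for k x y
      proof -
        have "norm (u k x - u k y) \<le> 2 * (A * (2 ^ k) powr (\<eta> - s))"
          using norm_triangle_ineq4[of "u k x" "u k y"] A(1)[of k x] A(1)[of k y] by linarith
        then have "norm (u k x - u k y) \<le> 2 * (A * (2 ^ k) powr (\<eta> - s)) * (2 ^ k * dist x y) powr \<gamma>"
          using A(2)[of k x y] \<open>0 \<le> A\<close> \<gamma> assms(3) by (intro powr_interpolate) auto
        also have "\<dots> = 2 * A * ((2 ^ k) powr (\<eta> - s) * (2 ^ k) powr \<gamma>) * dist x y powr \<gamma>"
          by (simp only: powr_mult mult_ac)
        also have "((2::real) ^ k) powr (\<eta> - s) * (2 ^ k) powr \<gamma> = (2 ^ k) powr (- (s - \<gamma> - \<eta>))"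
          by (simp only: powr_add[symmetric]) (simp add: algebra_simps)
        finally show ?thesis
          by (simp only: b_def)
      qed
      have "dist (v x) (v y) \<le> (K0 + suminf b) * dist x y powr \<gamma>" for x y
      proof -
        have "(\<Sum>k. u k x) - (\<Sum>k. u k y) = (\<Sum>k. u k x - u k y)"
          by (rule suminf_diff[OF sum_u sum_u])
        also have "norm \<dots> \<le> (\<Sum>k. b k * dist x y powr \<gamma>)"
          by (rule norm_suminf_le[OF diff_le summable_mult2[OF b_sum]])
        also have "\<dots> = suminf b * dist x y powr \<gamma>"
          by (rule suminf_mult2[OF b_sum, symmetric])
        finally have "norm ((\<Sum>k. u k x) - (\<Sum>k. u k y)) \<le> suminf b * dist x y powr \<gamma>" .
        then show ?thesis
          using norm_diff_triangle_ineq[of "trig_poly c {m. freq_max m \<le> 1} x" "\<Sum>k. u k x"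
              "trig_poly c {m. freq_max m \<le> 1} y" "\<Sum>k. u k y"] K0(2)[of x y]
          by (simp add: v_def dist_norm distrib_right)
      qed
      with per show ?thesis
        unfolding holder_torus_def by blast
    qed
    have "L2_torus v"
      unfolding L2_torus_def
      using per borel_measurable_continuous_onI[OF cont]
      by (auto intro!: integrable_cube_continuous continuous_intros cont measurable_completion)
    moreover have "((\<lambda>F. LINT x|lebesgue_on cube. (norm (v x - trig_poly c F x))\<^sup>2) \<longlongrightarrow> 0)
        (finite_subsets_at_top UNIV)"
    \<comment> \<open>The dyadic frequency cubes serve as the exhausting sequence.\<close>
    proof (rule L2_unconditional_of_uniform_limit[OF finite_freq_max _ _ lim])
      show "mono (\<lambda>n. {m :: int^'n. freq_max m \<le> int (2 ^ n)})"
        by (auto intro!: monoI elim!: order_trans)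
      have "\<exists>n. freq_max m \<le> int (2 ^ n)" for m :: "int^'n"
      proof -
        have "freq_max m \<le> int (nat (freq_max m))"
          by simp
        also have "\<dots> \<le> int (2 ^ nat (freq_max m))"
          by (simp only: of_nat_le_iff less_imp_le[OF less_exp])
        finally show ?thesis by blast
      qed
      then show "(\<Union>n. {m :: int^'n. freq_max m \<le> int (2 ^ n)}) = UNIV"
        by blast
    qed
    ultimately have "evolution f t v"
      by (simp add: evolution_def c_def evolved_coeff_def[abs_def] trig_poly_def)
    with holder show ?case
      using graph_dim_le_of_holder[OF holder assms(2,3)] by blast
  qed
qed

end
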